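(* Let $n\ge3$, $q=3^n$, and $a\in\mathbb{F}_q$. Let $\mathcal{K}_q(a)=\sum_{x\in\mathbb{F}_q}\zeta^{\mathrm{Tr}(x^{-1}+ax)}$ (with $0^{-1}:=0$). Define $\widehat{\mathrm{Tr}}(a)=\sum_{i=0}^{n-1}\omega(a)^{3^i}$ and $\widehat{\tau_X}(a)=\sum_{s\in X}\omega(a)^{s}$, where $X=\{r\in\{0,\dots,q-2\}: r=3^i+3^j \text{ for some } i,j\in\{0,\dots,n-1\}\text{ (not necessarily distinct)}\}$. Then, in the ring of integers of $\mathbb{Q}_3(\zeta,\xi)$, \[\mathcal{K}_{q}(a)\equiv 21\,\widehat{\mathrm{Tr}}(a)+18\,\widehat{\tau_X}(a)\pmod{27}.\]
   Context: Fix an algebraic closure of $\mathbb{Q}_3$; let $\xi$ be a primitive $(q-1)$-th root of unity and $\zeta$ a primitive $3$rd root of unity in it. $\mathrm{Tr}:\mathbb{F}_q\to\mathbb{F}_3$ is the absolute trace $\mathrm{Tr}(c)=c+c^3+\dots+c^{3^{n-1}}$. $\omega:\mathbb{F}_q\to\mathbb{Q}_3(\xi)$ is the Teichmüller character: $\omega(t^k)=\xi^k$ for a fixed generator $t$ of $\mathbb{F}_q^\times$ (equivalently, the multiplicative character with $\omega(a)\equiv a$ modulo the prime above $3$), and $\omega(0)=0$. The set $X$ is regarded as a subset of $\mathbb{Z}/(q-1)\mathbb{Z}$. *)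

theory Defs
  imports
    "HOL-Algebra.Algebraic_Closure_Type"
    "HOL-Algebra.Generated_Fields"
begin

section \<open>The 3-adic integers and the 3-adic numbers\<close>

text \<open>The ring of 3-adic integers is the inverse limit of the rings \<open>\<int>/3\<^sup>k\<int>\<close>, an element of
  \<open>\<int>/3\<^sup>k\<int>\<close> being represented by its least nonnegative residue.\<close>

typedef z3 = "{x :: nat \<Rightarrow> int. (\<forall>k. x k mod 3 ^ k = x k) \<and> (\<forall>k. x (Suc k) mod 3 ^ k = x k)}"
  morphisms z3_residue Abs_z3
  by (rule exI[of _ "\<lambda>_. 0"]) simp

setup_lifting type_definition_z3

lemma mod_Suc_power3: "(a mod 3 ^ Suc k) mod 3 ^ k = a mod (3 ^ k :: int)"
  by (simp add: mod_mod_cancel)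

lemma z3_mod_add:
  fixes x y :: "nat \<Rightarrow> int"
  assumes "\<And>k. x (Suc k) mod 3 ^ k = x k" "\<And>k. y (Suc k) mod 3 ^ k = y k"
  shows "((x (Suc k) + y (Suc k)) mod 3 ^ Suc k) mod 3 ^ k = (x k + y k) mod 3 ^ k"
  by (metis assms mod_Suc_power3 mod_add_eq)

lemma z3_mod_mult:
  fixes x y :: "nat \<Rightarrow> int"
  assumes "\<And>k. x (Suc k) mod 3 ^ k = x k" "\<And>k. y (Suc k) mod 3 ^ k = y k"
  shows "((x (Suc k) * y (Suc k)) mod 3 ^ Suc k) mod 3 ^ k = (x k * y k) mod 3 ^ k"
  by (metis assms mod_Suc_power3 mod_mult_eq)

lemma z3_mod_uminus:
  fixes x :: "nat \<Rightarrow> int"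
  assumes "\<And>k. x (Suc k) mod 3 ^ k = x k"
  shows "((- x (Suc k)) mod 3 ^ Suc k) mod 3 ^ k = (- x k) mod 3 ^ k"
  by (metis assms mod_Suc_power3 mod_minus_eq)

lemma z3_mod_diff:
  fixes x y :: "nat \<Rightarrow> int"
  assumes "\<And>k. x (Suc k) mod 3 ^ k = x k" "\<And>k. y (Suc k) mod 3 ^ k = y k"
  shows "((x (Suc k) - y (Suc k)) mod 3 ^ Suc k) mod 3 ^ k = (x k - y k) mod 3 ^ k"
  by (metis assms mod_Suc_power3 mod_diff_eq)

instantiation z3 :: comm_ring_1
begin

lift_definition zero_z3 :: z3 is "\<lambda>_. 0"
  by simp

lift_definition one_z3 :: z3 is "\<lambda>k. 1 mod 3 ^ k"
  by (simp only: mod_Suc_power3 mod_mod_trivial) simp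

lift_definition plus_z3 :: "z3 \<Rightarrow> z3 \<Rightarrow> z3" is "\<lambda>x y k. (x k + y k) mod 3 ^ k"
  by (intro conjI allI mod_mod_trivial z3_mod_add) simp_all

lift_definition minus_z3 :: "z3 \<Rightarrow> z3 \<Rightarrow> z3" is "\<lambda>x y k. (x k - y k) mod 3 ^ k"
  by (intro conjI allI mod_mod_trivial z3_mod_diff) simp_all

lift_definition uminus_z3 :: "z3 \<Rightarrow> z3" is "\<lambda>x k. (- x k) mod 3 ^ k"
  by (intro conjI allI mod_mod_trivial z3_mod_uminus) simp_all

lift_definition times_z3 :: "z3 \<Rightarrow> z3 \<Rightarrow> z3" is "\<lambda>x y k. (x k * y k) mod 3 ^ k"
  by (intro conjI allI mod_mod_trivial z3_mod_mult) simp_all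

instance
proof
  fix a b c :: z3
  show "a + b + c = a + (b + c)"
    by transfer (simp add: mod_simps fun_eq_iff add.assoc)
  show "a + b = b + a"
    by transfer (simp add: add.commute)
  show "0 + a = a"
    by transfer auto
  show "- a + a = 0"
    by transfer (simp add: mod_simps fun_eq_iff)
  show "a - b = a + - b"
    by transfer (simp add: mod_simps fun_eq_iff)
  show "a * b * c = a * (b * c)"
    by transfer (simp add: mod_simps fun_eq_iff mult.assoc)
  show "a * b = b * a"
    by transfer (simp add: mult.commute)
  show "1 * a = a"
    by transfer (simp add: mod_simps fun_eq_iff)
  show "(a + b) * c = a * c + b * c"
    by transfer (simp add: mod_simps fun_eq_iff distrib_right)
  show "(0::z3) \<noteq> 1"
    by transfer (auto simp: fun_eq_iff intro!: exI[of _ 1])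
qed

end

lemma z3_residue_mod: "k \<le> m \<Longrightarrow> z3_residue x m mod 3 ^ k = z3_residue x k"
proof (induction m rule: dec_induct)
  case base
  then show ?case using z3_residue[of x] by simp
next
  case (step m)
  have "z3_residue x (Suc m) mod 3 ^ k = (z3_residue x (Suc m) mod 3 ^ m) mod 3 ^ k"
    using step by (simp add: mod_mod_cancel le_imp_power_dvd)
  also have "z3_residue x (Suc m) mod 3 ^ m = z3_residue x m"
    using z3_residue[of x] by simp
  finally show ?case using step by simp
qed

instance z3 :: idom
proof
  fix a b :: z3
  assume "a \<noteq> 0" "b \<noteq> 0"
  then obtain k l where kl: "z3_residue a k \<noteq> 0" "z3_residue b l \<noteq> 0"
    by transfer (auto simp: fun_eq_iff)
  have "\<not> 3 ^ k dvd z3_residue a (k + l)" "\<not> 3 ^ l dvd z3_residue b (k + l)"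
    using kl z3_residue_mod[of k "k + l" a] z3_residue_mod[of l "k + l" b]
    by (simp_all add: dvd_eq_mod_eq_0)
  moreover have "prime_elem (3 :: int)"
    by (simp add: prime_int_numeral_eq)
  ultimately have "\<not> 3 ^ (k + l) dvd z3_residue a (k + l) * z3_residue b (k + l)"
  proof (intro notI)
    assume nd: "\<not> 3 ^ k dvd z3_residue a (k + l)" "\<not> 3 ^ l dvd z3_residue b (k + l)"
      and "prime_elem (3 :: int)"
      and "3 ^ (k + l) dvd z3_residue a (k + l) * z3_residue b (k + l)"
    then obtain r s where rs: "r + s = k + l" "3 ^ r dvd z3_residue a (k + l)"
      "3 ^ s dvd z3_residue b (k + l)"
      using prime_elem_power_dvd_prod by blast
    from rs(1) have "k \<le> r \<or> l \<le> s" by linarith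
    with rs nd show False by (blast intro: power_le_dvd)
  qed
  hence "z3_residue (a * b) (k + l) \<noteq> 0"
    by (simp add: times_z3.rep_eq dvd_eq_mod_eq_0)
  thus "a * b \<noteq> 0"
    by (auto simp: zero_z3.rep_eq)
qed

type_synonym q3 = "z3 fract"

type_synonym q3_bar = "q3 alg_closure"

definition z3_to_q3_bar :: "z3 \<Rightarrow> q3_bar" where
  "z3_to_q3_bar x = to_ac (to_fract x)"

section \<open>Finite extensions of the 3-adic numbers and their rings of integers\<close>

definition q3_adjoin :: "q3_bar set \<Rightarrow> q3_bar set" where
  "q3_adjoin S = generate_field ring_of_type_algebra (range to_ac \<union> S)"

definition integral_over_z3 :: "q3_bar \<Rightarrow> bool" where
  "integral_over_z3 x \<longleftrightarrow>
     (\<exists>p :: z3 poly. lead_coeff p = 1 \<and> poly (map_poly z3_to_q3_bar p) x = 0)"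

definition ring_of_integers :: "q3_bar set \<Rightarrow> q3_bar set" where
  "ring_of_integers L = {x \<in> L. integral_over_z3 x}"

definition cong_in :: "'a::comm_ring_1 set \<Rightarrow> 'a \<Rightarrow> 'a \<Rightarrow> 'a \<Rightarrow> bool" where
  "cong_in A x y m \<longleftrightarrow> x \<in> A \<and> y \<in> A \<and> (\<exists>z\<in>A. x - y = m * z)"

definition primitive_root_of_unity :: "nat \<Rightarrow> 'a::monoid_mult \<Rightarrow> bool" where
  "primitive_root_of_unity m z \<longleftrightarrow> z ^ m = 1 \<and> (\<forall>k. 0 < k \<and> k < m \<longrightarrow> z ^ k \<noteq> 1)"

section \<open>Characters of the finite field\<close>

text \<open>A reduction map identifies the residue field of \<open>\<rat>\<^sub>3(\<xi>)\<close> with the finite field \<^typ>\<open>'f\<close>. The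
  ring of integers of \<open>\<rat>\<^sub>3(\<xi>)\<close> is local and every subring of a finite field is a field, so the
  kernel of any such homomorphism is the prime above 3.\<close>

definition reduction_map :: "q3_bar set \<Rightarrow> (q3_bar \<Rightarrow> 'f::field) \<Rightarrow> bool" where
  "reduction_map L red \<longleftrightarrow>
     red \<in> ring_hom (ring_of_type_algebra\<lparr>carrier := ring_of_integers L\<rparr>) ring_of_type_algebra"

definition generates_units :: "'f::field \<Rightarrow> bool" where
  "generates_units t \<longleftrightarrow> t \<noteq> 0 \<and> (\<forall>x. x \<noteq> 0 \<longrightarrow> (\<exists>k::nat. x = t ^ k))"

text \<open>The character sending \<open>t\<^sup>k\<close> to \<open>\<xi>\<^sup>k\<close>. It is the Teichmueller character precisely when \<open>\<xi>\<close>
  reduces to \<open>t\<close> modulo the prime above 3.\<close>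

definition teichmueller :: "'f::field \<Rightarrow> q3_bar \<Rightarrow> 'f \<Rightarrow> q3_bar" where
  "teichmueller t \<xi> x = (if x = 0 then 0 else \<xi> ^ (LEAST k. x = t ^ k))"

definition abs_trace :: "nat \<Rightarrow> 'f::field \<Rightarrow> 'f" where
  "abs_trace n c = (\<Sum>i<n. c ^ 3 ^ i)"

text \<open>The representative in \<open>{0, 1, 2}\<close> of an element of the prime field of a field of
  characteristic 3.\<close>

definition f3_rep :: "'f::field \<Rightarrow> nat" where
  "f3_rep c = (THE k. k < 3 \<and> of_nat k = c)"

text \<open>The convention that 0 is its own inverse is the one of the type class \<^class>\<open>field\<close>.\<close>

definition kloosterman :: "q3_bar \<Rightarrow> nat \<Rightarrow> 'f::{field,finite} \<Rightarrow> q3_bar" where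
  "kloosterman \<zeta> n a = (\<Sum>x\<in>UNIV. \<zeta> ^ f3_rep (abs_trace n (inverse x + a * x)))"

definition trace_hat :: "nat \<Rightarrow> ('f \<Rightarrow> q3_bar) \<Rightarrow> 'f \<Rightarrow> q3_bar" where
  "trace_hat n \<omega> a = (\<Sum>i<n. \<omega> a ^ 3 ^ i)"

definition X_set :: "nat \<Rightarrow> nat set" where
  "X_set n = {r \<in> {0..3 ^ n - 2}. \<exists>i<n. \<exists>j<n. r = 3 ^ i + 3 ^ j}"

definition tau_hat :: "nat set \<Rightarrow> ('f \<Rightarrow> q3_bar) \<Rightarrow> 'f \<Rightarrow> q3_bar" where
  "tau_hat S \<omega> a = (\<Sum>s\<in>S. \<omega> a ^ s)"

end

theory Submission
  imports Defs "Jordan_Normal_Form.Char_Poly"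
begin

text \<open>Let \<open>e(c) \<in> {0, 1, -1}\<close> be the integer representing \<open>Tr(c)\<close>. As \<open>\<zeta>\<^sup>r + \<zeta>\<^sup>-\<^sup>r = 2 - 3e\<^sup>2\<close>, the
  Kloosterman sum \<open>K\<close> is a rational integer, and expanding \<open>e(u + v)\<^sup>2\<close> in \<open>e(u)\<close> and \<open>e(v)\<close> gives
  \<open>4K \<equiv> 9E\<^sub>2 - 3E\<^sub>1 (mod 27)\<close> with \<open>E\<^sub>k = \<Sum>\<^sub>x (e(1/x) e(ax))\<^sup>k\<close>. For \<open>S(c) = \<Sum>\<^sub>i \<omega>(c)^(3^i)\<close> we have
  \<open>e \<equiv> S (mod 3)\<close>, hence \<open>e = e\<^sup>3 \<equiv> S\<^sup>3 = S + 3M (mod 9)\<close>, where \<open>M\<close> is a sum of powers of \<open>\<omega>\<close>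
  whose exponents have ternary digit sum 3. Orthogonality of characters kills the products of \<open>S\<close>
  and \<open>M\<close> and leaves \<open>E\<^sub>1 \<equiv> -S(a) (mod 9)\<close>; the same argument with \<open>S\<^sup>2\<close> gives
  \<open>E\<^sub>2 \<equiv> -\<tau>(a) (mod 3)\<close>. The congruence \<open>e \<equiv> S (mod 3)\<close> holds because \<open>e\<close> and \<open>S\<close> have the same
  reduction and idempotents of \<open>\<int>\<^sub>3[\<xi>]/3\<close> lift, by completeness, to idempotents of a domain.\<close>

section \<open>The 3-adic integers\<close>

lemma z3_eqI: "(\<And>k. z3_residue x k = z3_residue y k) \<Longrightarrow> x = y"
  by (metis ext z3_residue_inject)

lemma z3_residue_of_int: "z3_residue (of_int a) k = a mod 3 ^ k"
proof -
  have nat: "z3_residue (of_nat b) k = int b mod 3 ^ k" for b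
    by (induction b) (simp_all add: zero_z3.rep_eq one_z3.rep_eq plus_z3.rep_eq mod_simps)
  show ?thesis
    by (cases a rule: int_cases2) (simp_all add: nat uminus_z3.rep_eq mod_simps)
qed

text \<open>If the residue at level \<open>k\<close> vanishes, all later residues are multiples of
  \<open>3 ^ k\<close>; dividing the one at level \<open>k + j\<close> by \<open>3 ^ k\<close>
  yields level \<open>j\<close> of the quotient.\<close>

lemma power3_dvd_z3_iff: "3 ^ k dvd (x :: z3) \<longleftrightarrow> z3_residue x k = 0"
proof
  assume "3 ^ k dvd x"
  then obtain y where "x = of_int (3 ^ k) * y" by (auto elim: dvdE)
  then show "z3_residue x k = 0"
    by (simp only: times_z3.rep_eq z3_residue_of_int) simp
next
  assume 0: "z3_residue x k = 0"
  have dvd: "3 ^ k dvd z3_residue x (k + j)" for j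
    using z3_residue_mod[of k "k + j" x] 0 by (simp add: dvd_eq_mod_eq_0)
  define y where "y j = z3_residue x (k + j) div 3 ^ k" for j
  have y: "z3_residue x (k + j) = 3 ^ k * y j" for j
    using dvd[of j] by (simp add: y_def)
  have "y j mod 3 ^ j = y j" for j
  proof -
    have "(3 ^ k * y j) mod (3 ^ k * 3 ^ j) = 3 ^ k * y j"
      using z3_residue_mod[of "k + j" "k + j" x] by (simp add: y power_add)
    then show ?thesis by (simp flip: mult_mod_right)
  qed
  moreover have "y (Suc j) mod 3 ^ j = y j" for j
  proof -
    have "(3 ^ k * y (Suc j)) mod (3 ^ k * 3 ^ j) = 3 ^ k * y j"
      using z3_residue_mod[of "k + j" "k + Suc j" x] by (simp only: y power_add)
    then show ?thesis by (simp flip: mult_mod_right)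
  qed
  ultimately have res: "z3_residue (Abs_z3 y) = y"
    by (intro Abs_z3_inverse) simp
  have "x = of_int (3 ^ k) * Abs_z3 y"
  proof (rule z3_eqI)
    fix j
    have "3 ^ k * y j mod 3 ^ j = z3_residue x j"
      using z3_residue_mod[of j "k + j" x] by (simp add: y)
    then show "z3_residue x j = z3_residue (of_int (3 ^ k) * Abs_z3 y) j"
      by (simp only: times_z3.rep_eq z3_residue_of_int res mod_mult_left_eq)
  qed
  then show "3 ^ k dvd x" by simp
qed

text \<open>The limit is the diagonal, level \<open>k\<close> of the \<open>k\<close>-th term. The
  next term agrees with it on that level, which makes the diagonal compatible.\<close>

lemma z3_complete:
  fixes s :: "nat \<Rightarrow> z3"
  assumes "\<And>k. 3 ^ k dvd s (Suc k) - s k"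
  obtains A where "\<And>k. 3 ^ k dvd A - s k"
proof -
  have residue_eq: "z3_residue (s (Suc k)) k = z3_residue (s k) k" for k
  proof -
    have "(z3_residue (s (Suc k)) k - z3_residue (s k) k) mod 3 ^ k = 0"
      using assms[of k] by (simp add: power3_dvd_z3_iff minus_z3.rep_eq)
    then show ?thesis
      by (metis dual_order.refl mod_eq_dvd_iff mod_0_imp_dvd z3_residue_mod)
  qed
  define a where "a k = z3_residue (s k) k" for k
  have "z3_residue (Abs_z3 a) = a"
    by (intro Abs_z3_inverse) (simp add: a_def z3_residue_mod residue_eq)
  then have "3 ^ k dvd Abs_z3 a - s k" for k
    by (simp add: power3_dvd_z3_iff minus_z3.rep_eq a_def)
  then show thesis by (rule that)
qed

lemma z3_not_power3_dvd:
  assumes "(x :: z3) \<noteq> 0"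
  obtains k where "\<not> 3 ^ k dvd x"
  using assms z3_eqI[of x 0] by (auto simp: power3_dvd_z3_iff zero_z3.rep_eq)

lemma z3_cong_residue: "3 ^ k dvd x - of_int (z3_residue x k)"
  by (simp add: power3_dvd_z3_iff minus_z3.rep_eq z3_residue_of_int)

interpretation z3_hom: comm_ring_hom z3_to_q3_bar
  by unfold_locales (simp_all add: z3_to_q3_bar_def)

instance z3 :: ring_char_0
proof
  show "inj (of_nat :: nat \<Rightarrow> z3)"
  proof (rule injI)
    fix m n :: nat
    assume eq: "(of_nat m :: z3) = of_nat n"
    have "int m mod 3 ^ (m + n) = int n mod 3 ^ (m + n)"
      using arg_cong[OF eq, of "\<lambda>x. z3_residue x (m + n)"] z3_residue_of_int[of "int m"]
        z3_residue_of_int[of "int n"] by simp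
    moreover have "m < 3 ^ (m + n)" "n < 3 ^ (m + n)"
      using less_exp[of "m + n"] power_mono[of "2 :: nat" 3 "m + n"] by linarith+
    then have "int m < 3 ^ (m + n)" "int n < 3 ^ (m + n)"
      by (metis of_nat_less_iff of_nat_numeral of_nat_power)+
    ultimately show "m = n" by simp
  qed
qed

lemma z3_to_q3_bar_eq_0_iff: "z3_to_q3_bar x = 0 \<longleftrightarrow> x = 0"
  by (simp add: z3_to_q3_bar_def)

lemma of_nat_q3_bar_eq_0_iff [simp]: "(of_nat k :: q3_bar) = 0 \<longleftrightarrow> k = 0"
proof -
  have "z3_to_q3_bar (of_nat k) = of_nat k"
    by (simp add: hom_distribs)
  then show ?thesis
    by (metis of_nat_eq_0_iff z3_to_q3_bar_eq_0_iff)
qed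

section \<open>The ring generated by a root of unity over the 3-adic integers\<close>

text \<open>The characteristic polynomial of \<open>M\<close> is monic over the 3-adic integers and
  vanishes at \<open>x\<close>, so it serves as the integral equation.\<close>

lemma integral_over_z3_eigenvalue:
  assumes "v \<noteq> (0\<^sub>v m)" "v \<in> carrier_vec m" "M \<in> carrier_mat m m"
    and "map_mat z3_to_q3_bar M *\<^sub>v v = x \<cdot>\<^sub>v v"
  shows "integral_over_z3 x"
proof -
  have M': "map_mat z3_to_q3_bar M \<in> carrier_mat m m"
    using assms by simp
  have "eigenvalue (map_mat z3_to_q3_bar M) x"
    unfolding eigenvalue_def eigenvector_def using assms by (intro exI[of _ v]) auto
  then have "poly (char_poly (map_mat z3_to_q3_bar M)) x = 0"
    using eigenvalue_root_char_poly[OF M'] by simp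
  moreover have "lead_coeff (char_poly M) = 1"
    using degree_monic_char_poly[OF assms(3)] by simp
  ultimately show ?thesis
    unfolding integral_over_z3_def z3_hom.char_poly_hom[OF assms(3)]
    by (intro exI[of _ "char_poly M"]) simp
qed

text \<open>This is the ring \<open>Z_3[\<xi>]\<close> once \<open>\<xi> ^ m = 1\<close>. Spanning
  by the powers below \<open>m\<close>, without asking for independence, lets limits be taken
  coefficient by coefficient.\<close>

definition z3_adjoin_root :: "nat \<Rightarrow> q3_bar \<Rightarrow> q3_bar set" where
  "z3_adjoin_root m \<xi> = (\<lambda>a. \<Sum>i<m. z3_to_q3_bar (a i) * \<xi> ^ i) ` UNIV"

locale z3_root_of_unity =
  fixes m :: nat and \<xi> :: q3_bar
  assumes m_pos: "m > 0" and xi_power: "\<xi> ^ m = 1"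
begin

abbreviation "R \<equiv> z3_adjoin_root m \<xi>"

lemma R_I: "x = (\<Sum>i<m. z3_to_q3_bar (a i) * \<xi> ^ i) \<Longrightarrow> x \<in> R"
  by (auto simp: z3_adjoin_root_def)

lemma R_E:
  assumes "x \<in> R"
  obtains a where "x = (\<Sum>i<m. z3_to_q3_bar (a i) * \<xi> ^ i)"
  using assms by (auto simp: z3_adjoin_root_def)

lemma R_add: "x \<in> R \<Longrightarrow> y \<in> R \<Longrightarrow> x + y \<in> R"
  by (elim R_E, rule_tac a = "\<lambda>i. a i + aa i" in R_I)
     (simp add: hom_distribs algebra_simps sum.distrib)

lemma R_z3_mult: "x \<in> R \<Longrightarrow> z3_to_q3_bar c * x \<in> R"
  by (elim R_E, rule_tac a = "\<lambda>i. c * a i" in R_I)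
     (simp add: hom_distribs algebra_simps sum_distrib_left)

lemma R_0: "0 \<in> R"
  by (rule R_I[of _ "\<lambda>_. 0"]) simp

lemma R_sum: "(\<And>i. i \<in> I \<Longrightarrow> f i \<in> R) \<Longrightarrow> sum f I \<in> R"
  by (induction I rule: infinite_finite_induct) (auto intro: R_0 R_add)

lemma R_power_lt:
  assumes "k < m"
  shows "\<xi> ^ k \<in> R"
proof (rule R_I)
  show "\<xi> ^ k = (\<Sum>i<m. z3_to_q3_bar (if i = k then 1 else 0) * \<xi> ^ i)"
  proof -
    have "(\<Sum>i<m. z3_to_q3_bar (if i = k then 1 else 0) * \<xi> ^ i) = (\<Sum>i<m. if i = k then \<xi> ^ i else 0)"
      by (intro sum.cong) auto
    then show ?thesis using assms by simp
  qed
qed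

lemma R_power: "\<xi> ^ k \<in> R"
proof -
  have "\<xi> ^ k = \<xi> ^ (k mod m)"
    by (metis mod_mult_div_eq mult_1_right power_add power_mult power_one xi_power)
  then show ?thesis using R_power_lt[of "k mod m"] m_pos by simp
qed

lemma R_mult:
  assumes "x \<in> R" "y \<in> R"
  shows "x * y \<in> R"
proof -
  obtain a where a: "x = (\<Sum>i<m. z3_to_q3_bar (a i) * \<xi> ^ i)"
    using assms by (rule_tac R_E)
  obtain b where b: "y = (\<Sum>i<m. z3_to_q3_bar (b i) * \<xi> ^ i)"
    using assms by (rule_tac R_E)
  have "x * y = (\<Sum>i<m. \<Sum>j<m. z3_to_q3_bar (a i) * (z3_to_q3_bar (b j) * \<xi> ^ (i + j)))"
    by (simp add: a b sum_product power_add algebra_simps)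
  also have "\<dots> \<in> R"
    by (intro R_sum R_z3_mult R_power)
  finally show ?thesis .
qed

lemma R_1: "1 \<in> R"
  using R_power[of 0] by simp

lemma R_z3: "z3_to_q3_bar c \<in> R"
  using R_z3_mult[OF R_1, of c] by simp

lemma R_of_int: "of_int c \<in> R"
  using R_z3[of "of_int c"] by (simp add: hom_distribs)

lemma R_of_nat: "of_nat c \<in> R"
  using R_of_int[of "int c"] by simp

lemma R_numeral: "numeral c \<in> R"
  using R_of_nat[of "numeral c"] by simp

lemma R_uminus: "x \<in> R \<Longrightarrow> - x \<in> R"
  using R_mult[OF R_of_int[of "-1"], of x] by simp

lemma R_diff: "x \<in> R \<Longrightarrow> y \<in> R \<Longrightarrow> x - y \<in> R"
  using R_add[OF _ R_uminus, of x y] by simp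

lemma R_pow: "x \<in> R \<Longrightarrow> x ^ k \<in> R"
  by (induction k) (auto intro: R_1 R_mult)

lemmas R_intros = R_add R_mult R_diff R_uminus R_pow R_sum R_of_int R_of_nat R_numeral
  R_0 R_1 R_power

text \<open>Multiplication by \<open>x\<close> maps the span of the powers of \<open>\<xi>\<close>
  into itself; the matrix \<open>A\<close> of this map has the vector of powers as an eigenvector
  for \<open>x\<close>.\<close>

lemma R_integral:
  assumes "x \<in> R"
  shows "integral_over_z3 x"
proof -
  have "\<exists>a. x * \<xi> ^ i = (\<Sum>j<m. z3_to_q3_bar (a j) * \<xi> ^ j)" for i
    using R_mult[OF assms R_power[of i]] by (auto elim: R_E)
  then obtain A where A: "\<And>i. x * \<xi> ^ i = (\<Sum>j<m. z3_to_q3_bar (A i j) * \<xi> ^ j)"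
    by metis
  show ?thesis
  proof (rule integral_over_z3_eigenvalue)
    show "vec m (\<lambda>i. \<xi> ^ i) \<noteq> 0\<^sub>v m"
    proof
      assume "vec m (\<lambda>i. \<xi> ^ i) = 0\<^sub>v m"
      then have "vec m (\<lambda>i. \<xi> ^ i) $ 0 = (0\<^sub>v m $ 0 :: q3_bar)" by simp
      then show False using m_pos by simp
    qed
    show "map_mat z3_to_q3_bar (mat m m (\<lambda>(i, j). A i j)) *\<^sub>v vec m (\<lambda>i. \<xi> ^ i)
      = x \<cdot>\<^sub>v vec m (\<lambda>i. \<xi> ^ i)"
      by (rule eq_vecI) (simp_all add: A scalar_prod_def lessThan_atLeast0)
  qed simp_all
qed

lemma R_subset_ring_of_integers:
  assumes "\<xi> \<in> S"
  shows "R \<subseteq> ring_of_integers (q3_adjoin S)"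
proof
  fix x assume x: "x \<in> R"
  let ?F = "q3_adjoin S"
  have one: "1 \<in> ?F"
    using generate_field.one[of ring_of_type_algebra]
    by (simp add: q3_adjoin_def ring_of_type_algebra_def)
  have add: "a + b \<in> ?F" and mult: "a * b \<in> ?F" if "a \<in> ?F" "b \<in> ?F" for a b
    using generate_field.eng_add[of a ring_of_type_algebra _ b]
      generate_field.eng_mult[of a ring_of_type_algebra _ b] that
    by (simp_all add: q3_adjoin_def ring_of_type_algebra_def)
  have incl: "to_ac c \<in> ?F" "\<xi> \<in> ?F" for c
    using assms by (auto simp: q3_adjoin_def intro: generate_field.incl)
  have pow: "\<xi> ^ i \<in> ?F" for i
    by (induction i) (auto intro: one mult incl)
  have sum: "sum f {..<k} \<in> ?F" if "\<And>i. f i \<in> ?F" for f :: "nat \<Rightarrow> q3_bar" and k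
    using that incl(1)[of 0] by (induction k) (auto intro: add)
  from x obtain a where "x = (\<Sum>i<m. z3_to_q3_bar (a i) * \<xi> ^ i)"
    by (rule R_E)
  then have "x \<in> ?F"
    by (auto intro!: sum mult incl pow simp: z3_to_q3_bar_def)
  then show "x \<in> ring_of_integers (q3_adjoin S)"
    using R_integral[OF x] by (simp add: ring_of_integers_def)
qed

text \<open>An integral equation for \<open>x\<close> is stripped of factors \<open>x\<close> until
  its constant term is nonzero; that term is then a multiple of \<open>x\<close>. Questions about
  \<open>R\<close> are thereby carried back to 3-adic integers.\<close>

lemma R_dvd_constant:
  assumes "x \<in> R" "x \<noteq> 0"
  obtains c r where "c \<noteq> 0" "r \<in> R" "z3_to_q3_bar c = x * r"
proof -
  obtain p :: "z3 poly" where "lead_coeff p = 1" "poly (map_poly z3_to_q3_bar p) x = 0"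
    using R_integral[OF assms(1)] by (auto simp: integral_over_z3_def)
  then have "p \<noteq> 0" "poly (map_poly z3_to_q3_bar p) x = 0"
    by auto
  then have "\<exists>c r. c \<noteq> 0 \<and> r \<in> R \<and> z3_to_q3_bar c = x * r"
  proof (induction p rule: pCons_induct)
    case 0
    then show ?case by simp
  next
    case (pCons c p)
    have poly_R: "poly (map_poly z3_to_q3_bar q) x \<in> R" for q
      by (induction q) (auto simp: map_poly_pCons intro!: R_intros R_z3 assms)
    have eq: "z3_to_q3_bar c + x * poly (map_poly z3_to_q3_bar p) x = 0"
      using pCons.prems by (simp add: map_poly_pCons)
    show ?case
    proof (cases "c = 0")
      case True
      then show ?thesis using pCons eq assms by auto
    next
      case False
      have "z3_to_q3_bar c = x * - poly (map_poly z3_to_q3_bar p) x"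
        using eq by (simp add: eq_neg_iff_add_eq_0)
      then show ?thesis using False poly_R R_uminus by blast
    qed
  qed
  then show thesis using that by blast
qed

lemma R_complete:
  assumes "\<And>k. s k \<in> R" and "\<And>k. \<exists>r\<in>R. s (Suc k) - s k = 3 ^ k * r"
  obtains E where "E \<in> R" "\<And>k. \<exists>r\<in>R. E - s k = 3 ^ k * r"
proof -
  let ?c = "\<lambda>a. \<Sum>i<m. z3_to_q3_bar (a i) * \<xi> ^ i"
  have "\<exists>a. s (Suc k) - s k = 3 ^ k * ?c a" for k
    using assms(2)[of k] by (auto elim!: R_E)
  then obtain D where D: "\<And>k. s (Suc k) - s k = 3 ^ k * ?c (D k)" by metis
  obtain a0 where a0: "s 0 = ?c a0" using assms(1)[of 0] by (auto elim: R_E)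
  \<comment> \<open>Coefficients need not be unique, so coherent ones are built:
    \<open>t i k\<close> accumulates the coefficients of successive differences and is Cauchy in
    \<open>k\<close>.\<close>
  define t where "t i k = a0 i + (\<Sum>l<k. 3 ^ l * D l i)" for i k
  have s: "s k = ?c (\<lambda>i. t i k)" for k
  proof (induction k)
    case 0
    then show ?case by (simp add: t_def a0)
  next
    case (Suc k)
    have "s (Suc k) = s k + 3 ^ k * ?c (D k)"
      using D[of k] by (simp add: algebra_simps)
    also have "\<dots> = ?c (\<lambda>i. t i (Suc k))"
      by (simp add: Suc t_def hom_distribs sum.distrib sum_distrib_left algebra_simps)
    finally show ?case .
  qed
  have "\<exists>A. \<forall>k. 3 ^ k dvd A - t i k" for i
    by (rule z3_complete[of "t i"]) (auto simp: t_def)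
  then obtain A where A: "\<And>i k. 3 ^ k dvd A i - t i k" by metis
  show thesis
  proof (rule that)
    show "?c A \<in> R" by (rule R_I) simp
    fix k
    have "\<exists>b. \<forall>i. A i - t i k = 3 ^ k * b i"
      using A[of k] unfolding dvd_def by (intro choice) blast
    then obtain b where "\<And>i. A i - t i k = 3 ^ k * b i" by blast
    then have b: "\<And>i. A i = t i k + 3 ^ k * b i" by (simp add: algebra_simps)
    have "?c A - s k = 3 ^ k * ?c b"
      by (simp add: b s hom_distribs sum.distrib sum_distrib_left algebra_simps)
    then show "\<exists>r\<in>R. ?c A - s k = 3 ^ k * r" by (auto intro: R_I)
  qed
qed

end

section \<open>Reduction modulo 3\<close>

locale z3_reduction = z3_root_of_unity +
  fixes red :: "q3_bar \<Rightarrow> 'f::field"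
  assumes red_add: "x \<in> R \<Longrightarrow> y \<in> R \<Longrightarrow> red (x + y) = red x + red y"
    and red_mult: "x \<in> R \<Longrightarrow> y \<in> R \<Longrightarrow> red (x * y) = red x * red y"
    and red_1: "red 1 = 1"
    and residue_char: "(3 :: 'f) = 0"
begin

section \<open>The ideals generated by powers of 3\<close>

definition I :: "nat \<Rightarrow> q3_bar set" where
  "I k = (\<lambda>r. 3 ^ k * r) ` R"

lemma I_subset_R: "x \<in> I k \<Longrightarrow> x \<in> R"
  by (auto simp: I_def intro: R_intros)

lemma I_add: "x \<in> I k \<Longrightarrow> y \<in> I k \<Longrightarrow> x + y \<in> I k"
  by (auto simp: I_def intro!: R_add simp flip: distrib_left)

lemma I_mult: "x \<in> I k \<Longrightarrow> y \<in> R \<Longrightarrow> x * y \<in> I k"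
  by (auto simp: I_def mult.assoc intro!: R_mult)

lemma I_mult': "x \<in> I k \<Longrightarrow> y \<in> R \<Longrightarrow> y * x \<in> I k"
  using I_mult[of x k y] by (simp add: mult.commute)

lemma I_mult_I: "x \<in> I k \<Longrightarrow> y \<in> I l \<Longrightarrow> x * y \<in> I (k + l)"
  by (auto simp: I_def power_add image_iff intro!: bexI[OF _ R_mult])

lemma I_uminus: "x \<in> I k \<Longrightarrow> - x \<in> I k"
  using I_mult[OF _ R_of_int[of "-1"], of x k] by simp

lemma I_diff: "x \<in> I k \<Longrightarrow> y \<in> I k \<Longrightarrow> x - y \<in> I k"
  using I_add[OF _ I_uminus, of x k y] by simp

lemma I_sum: "(\<And>i. i \<in> A \<Longrightarrow> f i \<in> I k) \<Longrightarrow> sum f A \<in> I k"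
proof (induction A rule: infinite_finite_induct)
  case (insert x A)
  then show ?case by (auto intro: I_add)
qed (use R_0 in \<open>auto simp: I_def image_iff intro: bexI[of _ 0]\<close>)

lemma I_mono: "x \<in> I k \<Longrightarrow> l \<le> k \<Longrightarrow> x \<in> I l"
  by (auto simp: I_def image_iff le_iff_add power_add mult.assoc
    intro!: bexI[OF _ R_mult[OF R_pow[OF R_numeral]]])

lemma I_power3: "r \<in> R \<Longrightarrow> 3 ^ k * r \<in> I k"
  by (auto simp: I_def)

lemma red_0: "red 0 = 0"
  using red_add[OF R_0 R_0] by (metis add_0_right add_left_cancel)

lemma red_uminus: "x \<in> R \<Longrightarrow> red (- x) = - red x"
  using red_add[of x "- x"] by (simp add: R_uminus red_0 add_eq_0_iff)

lemma red_diff: "x \<in> R \<Longrightarrow> y \<in> R \<Longrightarrow> red (x - y) = red x - red y"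
  using red_add[of x "- y"] by (simp add: R_uminus red_uminus)

lemma red_of_nat: "red (of_nat k) = of_nat k"
  by (induction k) (simp_all add: red_0 red_add red_1 R_1 R_of_nat)

lemma red_of_int: "red (of_int k) = of_int k"
  by (cases k rule: int_cases2) (simp_all add: red_of_nat red_uminus R_of_nat)

lemma red_sum: "(\<And>i. i \<in> A \<Longrightarrow> f i \<in> R) \<Longrightarrow> red (sum f A) = (\<Sum>i\<in>A. red (f i))"
  by (induction A rule: infinite_finite_induct) (auto simp: red_0 red_add R_sum)

lemma red_power: "x \<in> R \<Longrightarrow> red (x ^ k) = red x ^ k"
  by (induction k) (simp_all add: red_1 red_mult R_pow)

lemma red_I:
  assumes "x \<in> I (Suc k)"
  shows "red x = 0"
proof -
  obtain r where r: "r \<in> R" "x = 3 * (3 ^ k * r)"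
    using assms by (auto simp: I_def mult.assoc)
  have "red x = red (of_nat 3) * red (3 ^ k * r)"
    using r by (simp add: red_mult R_intros)
  then show ?thesis
    by (simp only: red_of_nat) (simp add: residue_char)
qed

lemma one_not_in_I: "1 \<notin> I (Suc 0)"
  using red_I[of 1 0] red_1 by auto

text \<open>By Bezout such a membership would put 1 into \<open>I (Suc 0)\<close>, yet
  \<open>red\<close> sends that ideal to 0 and 1 to 1.\<close>

lemma coprime_3_not_in_I:
  assumes "\<not> 3 dvd (d :: int)"
  shows "of_int d \<notin> I (Suc 0)"
proof
  assume d: "of_int d \<in> I (Suc 0)"
  have "coprime 3 d"
    using assms by (intro prime_imp_coprime) simp_all
  then obtain a b where "a * d + b * 3 = 1"
    using bezout_int[of d 3] by (auto simp: coprime_iff_gcd_eq_1 gcd.commute)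
  then have "1 = of_int a * of_int d + 3 ^ Suc 0 * (of_int b :: q3_bar)"
    by (metis mult.commute of_int_1 of_int_add of_int_mult of_int_numeral power_one_right One_nat_def)
  moreover have "\<dots> \<in> I (Suc 0)"
    by (intro I_add I_mult' d I_power3 R_of_int)
  ultimately show False using one_not_in_I by simp
qed

text \<open>A nonzero \<open>x\<close> divides a nonzero 3-adic integer \<open>c\<close>, which
  would then lie in every \<open>I k\<close>. Approximating \<open>c\<close> by an ordinary integer
  and cancelling its 3-part leaves an integer prime to 3 in \<open>I (Suc 0)\<close>.\<close>

lemma Inter_I:
  assumes "\<And>k. x \<in> I k"
  shows "x = 0"
proof (rule ccontr)
  assume "x \<noteq> 0"
  moreover have "x \<in> R" using assms[of 0] by (rule I_subset_R)
  ultimately obtain c r where c: "c \<noteq> 0" "r \<in> R" "z3_to_q3_bar c = x * r"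
    using R_dvd_constant by blast
  obtain k where k: "\<not> 3 ^ k dvd c"
    using c(1) by (rule z3_not_power3_dvd)
  define d where "d = z3_residue c k"
  obtain c' where c': "c - of_int d = 3 ^ k * c'"
    using z3_cong_residue[of k c] by (auto simp: d_def elim: dvdE)
  have "of_int d = z3_to_q3_bar c - 3 ^ k * z3_to_q3_bar c'"
    using arg_cong[OF c', of z3_to_q3_bar] by (simp add: hom_distribs algebra_simps)
  moreover have "\<dots> \<in> I k"
    unfolding c(3) by (intro I_diff I_mult assms c I_power3 R_z3)
  ultimately have d: "of_int d \<in> I k" by simp
  have "\<not> 3 ^ k dvd d"
  proof
    assume "3 ^ k dvd d"
    then obtain b where "d = 3 ^ k * b" by (rule dvdE)
    then have "(3 :: z3) ^ k dvd of_int d" by simp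
    with c' k show False
      by (metis dvd_add_right_iff dvd_triv_left diff_add_cancel)
  qed
  then have "d \<noteq> 0" by auto
  define v where "v = multiplicity 3 d"
  obtain d' where d': "d = 3 ^ v * d'" "\<not> 3 dvd d'"
    using multiplicity_decompose'[of d 3] \<open>d \<noteq> 0\<close> unfolding v_def by auto
  have "v < k"
    using \<open>\<not> 3 ^ k dvd d\<close> d' by (metis dvd_mult2 le_imp_power_dvd not_less)
  then obtain j where j: "k = v + Suc j"
    using less_iff_Suc_add by auto
  from d obtain r where r: "r \<in> R" "of_int d = 3 ^ k * r" by (auto simp: I_def)
  then have "3 ^ v * of_int d' = 3 ^ v * (3 ^ Suc j * r)"
    by (simp add: d' j power_add mult.assoc)
  then have "of_int d' = 3 ^ Suc j * r"
    using of_nat_q3_bar_eq_0_iff[of 3] by simp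
  then have "of_int d' \<in> I (Suc j)" using r by (simp only: I_power3)
  then have "of_int d' \<in> I (Suc 0)" by (rule I_mono) simp
  then show False using coprime_3_not_in_I[OF d'(2)] by simp
qed

text \<open>In the expansion of the cube the mixed terms carry an extra factor 3, and the cube of
  the difference is divisible enough by itself.\<close>

lemma cube_cong:
  assumes "a \<in> R" "b \<in> R" "a - b \<in> I (Suc k)"
  shows "a ^ 3 - b ^ 3 \<in> I (Suc (Suc k))"
proof -
  obtain r where r: "r \<in> R" "a = b + 3 ^ Suc k * r"
    using assms by (auto simp: I_def algebra_simps)
  have "a ^ 3 - b ^ 3 = 3 ^ Suc (Suc k) * (b\<^sup>2 * r + b * 3 ^ Suc k * r\<^sup>2 + 3 ^ k * 3 ^ Suc k * r ^ 3)"
    by (simp add: r power3_eq_cube power2_eq_square algebra_simps)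
  moreover have "\<dots> \<in> I (Suc (Suc k))"
    by (intro I_power3 R_intros assms r)
  ultimately show ?thesis by simp
qed

text \<open>Repeated cubing improves idempotence by one power of 3 each time and converges
  3-adically. The limit is an exact idempotent of a domain, hence 0 or 1, and it agrees with
  \<open>e\<close> modulo 3.\<close>

lemma approximate_idempotent:
  assumes e: "e \<in> R" and idem: "e\<^sup>2 - e \<in> I (Suc 0)"
  shows "e \<in> I (Suc 0) \<or> e - 1 \<in> I (Suc 0)"
proof -
  define s where "s k = e ^ 3 ^ k" for k
  have s: "s k \<in> R" for k
    by (simp add: s_def R_pow e)
  have s_Suc: "s (Suc k) = s k ^ 3" for k
    by (simp add: s_def power_mult mult.commute[of 3])
  have s_idem: "s k ^ 2 - s k \<in> I (Suc k)" for k
  proof (induction k)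
    case 0
    then show ?case using idem by (simp add: s_def)
  next
    case (Suc k)
    then show ?case
      using cube_cong[of "s k ^ 2" "s k" k] s by (simp add: s_Suc R_pow flip: power_mult)
  qed
  have s_cauchy: "s (Suc k) - s k \<in> I (Suc k)" for k
  proof -
    have "s (Suc k) - s k = (s k ^ 2 - s k) * (s k + 1)"
      by (simp add: s_Suc power2_eq_square power3_eq_cube algebra_simps)
    then show ?thesis using I_mult[OF s_idem R_add[OF s R_1]] by simp
  qed
  have "\<exists>r\<in>R. s (Suc k) - s k = 3 ^ k * r" for k
    using I_mono[OF s_cauchy[of k], of k] by (auto simp: I_def)
  then obtain E where E: "E \<in> R" "\<And>k. \<exists>r\<in>R. E - s k = 3 ^ k * r"
    using R_complete[of s] s by blast
  have E_s: "E - s k \<in> I k" for k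
    using E(2)[of k] by (auto simp: I_def)
  have "E ^ 2 - E \<in> I k" for k
  proof -
    have "E ^ 2 - E = (E - s k) * (E + s k - 1) + (s k ^ 2 - s k)"
      by (simp add: power2_eq_square algebra_simps)
    moreover have "s k ^ 2 - s k \<in> I k" by (rule I_mono[OF s_idem]) simp
    ultimately show ?thesis
      by (simp add: I_add I_mult E_s E s R_intros)
  qed
  then have "E ^ 2 - E = 0" by (rule Inter_I)
  then have "E * (E - 1) = 0" by (simp add: power2_eq_square algebra_simps)
  then have "E = 0 \<or> E = 1" by simp
  moreover have "e - E \<in> I (Suc 0)"
  proof -
    \<comment> \<open>\<open>E - s 0\<close> is only known to lie in \<open>I 0\<close>, so the
      comparison modulo 3 passes through \<open>s 1\<close>.\<close>
    have "e - E = - ((E - s 1) + (s (Suc 0) - s 0))"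
      by (simp add: s_def)
    then show ?thesis
      using I_uminus[OF I_add[OF E_s[of "Suc 0"] s_cauchy[of 0]]] by simp
  qed
  ultimately show ?thesis by auto
qed

text \<open>This stands in for the fact that 3 generates the prime of \<open>\<int>\<^sub>3[\<xi>]\<close>: \<open>x\<^sup>2\<close> is idempotent
  modulo 3, and the reduction excludes the case \<open>x\<^sup>2 \<equiv> 1\<close>.\<close>

lemma red_eq_0_imp_dvd:
  assumes x: "x \<in> R" "red x = 0" "x ^ 3 - x \<in> I (Suc 0)"
  shows "x \<in> I (Suc 0)"
proof -
  have "(x\<^sup>2)\<^sup>2 - x\<^sup>2 = x * (x ^ 3 - x)"
    by (simp add: power2_eq_square power3_eq_cube algebra_simps)
  then have "(x\<^sup>2)\<^sup>2 - x\<^sup>2 \<in> I (Suc 0)"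
    using I_mult'[OF x(3) x(1)] by simp
  then have "x\<^sup>2 \<in> I (Suc 0) \<or> x\<^sup>2 - 1 \<in> I (Suc 0)"
    by (intro approximate_idempotent R_pow x)
  moreover have "x\<^sup>2 - 1 \<notin> I (Suc 0)"
    using red_I[of "x\<^sup>2 - 1" 0] by (auto simp: red_diff red_power R_intros x red_1)
  ultimately have "x\<^sup>2 \<in> I (Suc 0)" by blast
  then have "x * x\<^sup>2 - (x ^ 3 - x) \<in> I (Suc 0)"
    by (intro I_diff I_mult' x)
  then show ?thesis by (simp add: power2_eq_square power3_eq_cube)
qed

end

section \<open>Traces and Kloosterman sums over a finite field of characteristic 3\<close>

lemma sum_uminus: "(\<Sum>x\<in>UNIV. h (- x :: 'a::{group_add,finite})) = (\<Sum>x\<in>UNIV. h x)"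
  by (rule sum.reindex_bij_witness[of _ uminus uminus]) simp_all

lemma sum_inverse: "(\<Sum>x\<in>UNIV. h (inverse x :: 'a::{field,finite})) = (\<Sum>x\<in>UNIV. h x)"
  by (rule sum.reindex_bij_witness[of _ inverse inverse]) simp_all

lemma sum_mult_left:
  assumes "a \<noteq> (0 :: 'a::{field,finite})"
  shows "(\<Sum>x\<in>UNIV. h (a * x)) = (\<Sum>x\<in>UNIV. h x)"
  by (rule sum.reindex_bij_witness[of _ "\<lambda>x. x / a" "\<lambda>x. a * x"]) (use assms in simp_all)

lemma sum_translate:
  "(\<Sum>x\<in>UNIV. h (x + c :: 'a::{ab_group_add,finite})) = (\<Sum>x\<in>UNIV. h x)"
  by (rule sum.reindex_bij_witness[of _ "\<lambda>x. x - c" "\<lambda>x. x + c"]) simp_all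

text \<open>Finiteness forces a repetition among the powers, so \<open>t\<close> has a finite order
  \<open>d\<close>. The powers below \<open>d\<close> are distinct and exhaust the nonzero elements,
  and counting gives \<open>d = N\<close>.\<close>

lemma generates_units_bij_betw:
  fixes t :: "'f::{field,finite}"
  assumes "generates_units t"
  defines "N \<equiv> card (UNIV :: 'f set) - 1"
  shows "t ^ N = 1" "bij_betw (\<lambda>k. t ^ k) {..<N} (UNIV - {0})"
proof -
  have t: "t \<noteq> 0" and gen: "\<And>x. x \<noteq> 0 \<Longrightarrow> \<exists>k. x = t ^ k"
    using assms(1) by (auto simp: generates_units_def)
  have "\<not> inj (\<lambda>k::nat. t ^ k)"
    using finite_imageD[of "\<lambda>k::nat. t ^ k" UNIV] by auto
  then obtain i j :: nat where ij: "i < j" "t ^ i = t ^ j"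
    by (metis injI linorder_neqE_nat)
  have "t ^ j = t ^ i * t ^ (j - i)"
    by (subst power_add[symmetric]) (use ij in simp)
  with ij t have ex: "0 < j - i \<and> t ^ (j - i) = 1" by simp
  define d where "d = (LEAST d. 0 < d \<and> t ^ d = 1)"
  have d: "0 < d" "t ^ d = 1"
    using LeastI[of "\<lambda>d. 0 < d \<and> t ^ d = 1", OF ex] by (auto simp: d_def)
  have min: "t ^ k \<noteq> 1" if "0 < k" "k < d" for k
    using not_less_Least[of k "\<lambda>d. 0 < d \<and> t ^ d = 1"] that by (auto simp: d_def)
  have "inj_on (\<lambda>k. t ^ k) {..<d}"
  proof (rule linorder_inj_onI)
    fix k l assume kl: "k < l" "k \<in> {..<d}" "l \<in> {..<d}"
    have "t ^ l = t ^ k * t ^ (l - k)"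
      using kl by (simp flip: power_add)
    then show "t ^ k \<noteq> t ^ l"
      using min[of "l - k"] kl t by auto
  qed auto
  moreover have "(\<lambda>k. t ^ k) ` {..<d} = UNIV - {0}"
  proof (intro equalityI subsetI)
    fix x assume "x \<in> UNIV - {0 :: 'f}"
    then obtain k where "x = t ^ k" using gen by auto
    also have "t ^ k = t ^ (k mod d + d * (k div d))" by simp
    also have "\<dots> = t ^ (k mod d)"
      by (simp only: power_add power_mult d power_one mult_1_right)
    finally show "x \<in> (\<lambda>k. t ^ k) ` {..<d}" using d by auto
  qed (use t in auto)
  ultimately have bij: "bij_betw (\<lambda>k. t ^ k) {..<d} (UNIV - {0})"
    by (simp add: bij_betw_def)
  then have "d = N"
    using bij_betw_same_card[OF bij] by (simp add: N_def card_Diff_singleton)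
  with bij d show "t ^ N = 1" "bij_betw (\<lambda>k. t ^ k) {..<N} (UNIV - {0})" by auto
qed

locale ternary_field =
  fixes n :: nat and t :: "'f::{field,finite}"
  assumes card_UNIV: "card (UNIV :: 'f set) = 3 ^ n"
    and generates: "generates_units t"
begin

lemma n_pos: "n > 0"
  using card_UNIV card_mono[of UNIV "{0, 1 :: 'f}"] by (cases n) auto

text \<open>Translation by 1 permutes the field; comparing the two sums of all elements gives
  \<open>3 ^ n = 0\<close>.\<close>

lemma three_eq_0: "(3 :: 'f) = 0"
proof -
  have "(\<Sum>x\<in>UNIV. x + 1) = (\<Sum>x\<in>(UNIV :: 'f set). x)"
    using sum_translate[of "\<lambda>x :: 'f. x" 1] by simp
  then have "(of_nat (3 ^ n) :: 'f) = 0"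
    by (simp add: sum.distrib card_UNIV del: of_nat_power)
  then show ?thesis by simp
qed

lemma add_self_eq: "(x :: 'f) + x = - x"
proof -
  have "x + x + x = 3 * x" by simp
  then show ?thesis by (simp add: three_eq_0 eq_neg_iff_add_eq_0)
qed

lemma two_eq: "(2 :: 'f) = - 1"
  using add_self_eq[of 1] by simp

lemma cube_add: "(x + y :: 'f) ^ 3 = x ^ 3 + y ^ 3"
proof -
  have "(x + y) ^ 3 = x ^ 3 + y ^ 3 + 3 * (x * x * y + x * y * y)"
    by (simp add: power3_eq_cube algebra_simps)
  then show ?thesis by (simp add: three_eq_0)
qed

lemma power_3_power_add: "(x + y :: 'f) ^ 3 ^ i = x ^ 3 ^ i + y ^ 3 ^ i"
  by (induction i) (simp_all add: power_mult[of _ "3 ^ _" 3] mult.commute[of 3] cube_add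
    del: power_Suc add: power_Suc2)

lemma sum_cube: "(sum h A :: 'f) ^ 3 = (\<Sum>i\<in>A. h i ^ 3)"
  by (induction A rule: infinite_finite_induct) (simp_all add: cube_add)

lemma power_card: "(x :: 'f) ^ 3 ^ n = x"
proof (cases "x = 0")
  case False
  then obtain k where "x = t ^ k"
    using generates by (auto simp: generates_units_def)
  moreover have "t ^ (3 ^ n - 1) = 1"
    using generates_units_bij_betw(1)[OF generates] by (simp add: card_UNIV)
  ultimately have "x ^ (3 ^ n - 1) = 1"
    by (metis mult.commute power_mult power_one)
  then have "x ^ Suc (3 ^ n - 1) = x" by (simp only: power_Suc mult_1_right)
  then show ?thesis by simp
qed simp

section \<open>The absolute trace and its balanced integer representative\<close>

lemma abs_trace_add: "abs_trace n (x + y :: 'f) = abs_trace n x + abs_trace n y"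
  by (simp add: abs_trace_def power_3_power_add sum.distrib)

lemma abs_trace_0: "abs_trace n (0 :: 'f) = 0"
  by (simp add: abs_trace_def power_0_left)

lemma abs_trace_uminus: "abs_trace n (- x :: 'f) = - abs_trace n x"
  using abs_trace_add[of x "- x"] by (simp add: abs_trace_0 eq_neg_iff_add_eq_0 add.commute)

text \<open>Cubing shifts the summands by one index, and the new last one,
  \<open>x ^ 3 ^ n = x\<close>, replaces the lost first one.\<close>

lemma abs_trace_cube: "abs_trace n (x :: 'f) ^ 3 = abs_trace n x"
proof -
  have "abs_trace n x ^ 3 = (\<Sum>i<n. x ^ 3 ^ Suc i)"
    by (simp add: abs_trace_def sum_cube mult.commute[of 3] flip: power_mult)
  also have "\<dots> = (\<Sum>i<Suc n. x ^ 3 ^ i) - x"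
    by (subst sum.lessThan_Suc_shift) simp
  also have "\<dots> = abs_trace n x"
    by (simp add: abs_trace_def power_card)
  finally show ?thesis .
qed

lemma abs_trace_cases:
  obtains "abs_trace n (x :: 'f) = 0" | "abs_trace n x = 1" | "abs_trace n x = - 1"
proof -
  have "abs_trace n x * (abs_trace n x - 1) * (abs_trace n x + 1) = 0"
    using abs_trace_cube[of x] by (simp add: power3_eq_cube algebra_simps)
  then show thesis using that by (auto simp: eq_neg_iff_add_eq_0)
qed

text \<open>As a polynomial the trace is nonzero of degree at most \<open>3 ^ (n - 1)\<close>, too
  small to vanish at all \<open>3 ^ n\<close> elements.\<close>

lemma abs_trace_nonzero: "\<exists>x :: 'f. abs_trace n x \<noteq> 0"
proof (rule ccontr)
  assume "\<not> ?thesis"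
  then have zero: "abs_trace n x = 0" for x :: 'f by simp
  define p :: "'f poly" where "p = (\<Sum>i<n. Polynomial.monom 1 (3 ^ i))"
  have "coeff p (3 ^ (n - 1)) = (\<Sum>i<n. if i = n - 1 then 1 else 0)"
    by (auto simp: p_def coeff_sum intro!: sum.cong)
  then have "p \<noteq> 0" using n_pos by auto
  have "degree p \<le> 3 ^ (n - 1)"
    unfolding p_def
  proof (intro degree_sum_le)
    fix i assume "i \<in> {..<n}"
    then have "i \<le> n - 1" by auto
    then show "degree (Polynomial.monom (1 :: 'f) (3 ^ i)) \<le> 3 ^ (n - 1)"
      by (simp add: degree_monom_eq)
  qed simp
  moreover have "poly p x = 0" for x
    using zero[of x] by (simp add: p_def poly_sum poly_monom abs_trace_def)
  then have "card (UNIV :: 'f set) \<le> degree p"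
    using card_poly_roots_bound[OF \<open>p \<noteq> 0\<close>] by simp
  moreover have "(3 :: nat) ^ (n - 1) < 3 ^ n"
    using n_pos by simp
  ultimately show False unfolding card_UNIV by linarith
qed

text \<open>This is \<open>e\<close> of the overview. The representatives 0, 1, -1, rather than 0,
  1, 2, make it odd and fixed by cubing.\<close>

definition tr :: "'f \<Rightarrow> int" where
  "tr x = (if abs_trace n x = 0 then 0 else if abs_trace n x = 1 then 1 else - 1)"

lemma minus_1_neq_1: "(- 1 :: 'f) \<noteq> 1"
proof
  assume "(- 1 :: 'f) = 1"
  then have "(2 :: 'f) = 1" using two_eq by simp
  then show False by (metis add_cancel_right_left one_add_one zero_neq_one)
qed

lemma tr_eq:
  "abs_trace n x = 0 \<Longrightarrow> tr x = 0"
  "abs_trace n x = 1 \<Longrightarrow> tr x = 1"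
  "abs_trace n x = - 1 \<Longrightarrow> tr x = - 1"
  using minus_1_neq_1 by (simp_all add: tr_def)

lemma of_int_tr: "of_int (tr x) = abs_trace n x"
  by (rule abs_trace_cases[of x]) (simp_all add: tr_eq)

lemma tr_0: "tr 0 = 0"
  by (simp add: tr_def abs_trace_0)

lemma tr_uminus: "tr (- x) = - tr x"
  by (rule abs_trace_cases[of x]) (simp_all add: tr_eq abs_trace_uminus)

lemma tr_cube: "tr x ^ 3 = tr x"
  by (simp add: tr_def)

text \<open>The identity is checked on the nine pairs of trace values; the factor 2 clears the
  denominators of the interpolating polynomial.\<close>

lemma tr_add_square:
  "2 * (tr (x + y))\<^sup>2 = 2 * (tr x)\<^sup>2 + 2 * (tr y)\<^sup>2 - 3 * (tr x * tr y)\<^sup>2 + tr x * tr y"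
  by (rule abs_trace_cases[of x]; rule abs_trace_cases[of y])
     (simp_all add: tr_eq abs_trace_add two_eq add_self_eq)

text \<open>For \<open>c\<close> of trace 1, the elements \<open>x\<close>, \<open>x + c\<close> and
  \<open>x - c\<close> have the traces 0, 1, -1 in some order, so their three squares add up to
  2.\<close>

lemma sum_tr_square: "3 * (\<Sum>x\<in>UNIV. (tr x)\<^sup>2) = 2 * 3 ^ n"
proof -
  obtain c :: 'f where c: "abs_trace n c = 1"
    using abs_trace_nonzero by (metis abs_trace_cases abs_trace_uminus minus_minus)
  have "(tr x)\<^sup>2 + (tr (x + c))\<^sup>2 + (tr (x + - c))\<^sup>2 = 2" for x
    by (rule abs_trace_cases[of x])
       (simp_all add: tr_eq abs_trace_add abs_trace_uminus c add_self_eq two_eq del: add_uminus_conv_diff)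
  then have "(\<Sum>x\<in>UNIV. (tr x)\<^sup>2 + (tr (x + c))\<^sup>2 + (tr (x + - c))\<^sup>2) = (\<Sum>x\<in>(UNIV :: 'f set). 2)"
    by simp
  then show ?thesis
    unfolding sum.distrib sum_translate[of "\<lambda>x. (tr x)\<^sup>2"] by (simp add: card_UNIV)
qed

section \<open>Cube roots of unity and the Kloosterman sum as an integer\<close>

lemma f3_rep_eq:
  "f3_rep (0 :: 'f) = 0" "f3_rep (1 :: 'f) = 1" "f3_rep (- 1 :: 'f) = 2"
proof -
  have less_3: "k < 3 \<longleftrightarrow> k = 0 \<or> k = 1 \<or> k = 2" for k :: nat by auto
  show "f3_rep (0 :: 'f) = 0" "f3_rep (1 :: 'f) = 1" "f3_rep (- 1 :: 'f) = 2"
    unfolding f3_rep_def less_3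
    by (rule the_equality; auto simp: two_eq minus_1_neq_1 minus_1_neq_1[symmetric])+
qed

lemma cube_root_power_add_power:
  fixes z :: "'a::idom"
  assumes "primitive_root_of_unity 3 z"
  shows "z ^ f3_rep (abs_trace n u) + z ^ f3_rep (abs_trace n (- u)) = of_int (2 - 3 * (tr u)\<^sup>2)"
proof -
  have "z ^ 3 = 1" "z ^ 1 \<noteq> 1"
    using assms unfolding primitive_root_of_unity_def by force+
  then have "z * z * z = 1" "z \<noteq> 1" by (simp_all add: power3_eq_cube)
  then have "(z - 1) * (z + z\<^sup>2 + 1) = 0"
    by (simp add: power2_eq_square algebra_simps)
  then have "z + z\<^sup>2 = - 1"
    using \<open>z \<noteq> 1\<close> by (simp add: eq_neg_iff_add_eq_0)
  then show ?thesis
    by (rule_tac abs_trace_cases[of u])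
       (simp_all add: f3_rep_eq abs_trace_uminus tr_eq add.commute)
qed

text \<open>This is \<open>E\<^sub>k\<close> of the overview, kept in \<open>int\<close> so that the
  divisibility by 27 below concerns ordinary integers.\<close>

definition corr :: "nat \<Rightarrow> 'f \<Rightarrow> int" where
  "corr k a = (\<Sum>x\<in>UNIV. (tr (inverse x) * tr (a * x)) ^ k)"

text \<open>Pairing \<open>x\<close> with \<open>- x\<close> turns twice the Kloosterman sum into a
  sum of terms \<open>2 - 3 * (tr (h x))\<^sup>2\<close>. Then \<open>tr_add_square\<close> brings
  in the correlations, and what remains of the separate square sums is a multiple of 27.\<close>

lemma kloosterman_integer:
  assumes z: "primitive_root_of_unity 3 z" and n: "n \<ge> 3"
  obtains m where "kloosterman z n (a :: 'f) = of_int m" "27 dvd 4 * m - (9 * corr 2 a - 3 * corr 1 a)"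
proof -
  define h where "h x = inverse x + a * x" for x
  have h_uminus: "h (- x) = - h x" for x
    by (simp add: h_def)
  \<comment> \<open>Since \<open>h\<close> is odd, \<open>tr (h x)\<close> takes the values 1 and -1
    equally often. Counting one of them exhibits a factor 2 that can be cancelled.\<close>
  define H :: int where "H = (\<Sum>x\<in>UNIV. of_bool (tr (h x) = 1))"
  define m where "m = 3 ^ n - 3 * H"
  have square: "(tr u)\<^sup>2 = of_bool (tr u = 1) + of_bool (tr (- u) = 1)" for u
    by (rule abs_trace_cases[of u]) (simp_all add: tr_eq tr_uminus)
  have G: "(\<Sum>x\<in>UNIV. (tr (h x))\<^sup>2) = 2 * H"
  proof -
    have "(\<Sum>x\<in>UNIV. (tr (h x))\<^sup>2) = (\<Sum>x\<in>UNIV. of_bool (tr (h x) = 1) + of_bool (tr (h (- x)) = 1))"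
      by (intro sum.cong) (simp_all add: h_uminus square)
    also have "\<dots> = 2 * H"
      by (simp only: sum.distrib sum_uminus[of "\<lambda>x. of_bool (tr (h x) = 1)"]) (simp add: H_def)
    finally show ?thesis .
  qed
  have K: "kloosterman z n a = (\<Sum>x\<in>UNIV. z ^ f3_rep (abs_trace n (h x)))"
    by (simp add: kloosterman_def h_def)
  have "2 * kloosterman z n a
      = (\<Sum>x\<in>UNIV. z ^ f3_rep (abs_trace n (h x)) + z ^ f3_rep (abs_trace n (- h x)))"
    unfolding sum.distrib K using sum_uminus[of "\<lambda>x. z ^ f3_rep (abs_trace n (h x))"]
    by (simp add: h_uminus)
  also have "\<dots> = of_int (\<Sum>x\<in>UNIV. 2 - 3 * (tr (h x))\<^sup>2)"
    by (simp only: cube_root_power_add_power[OF z] of_int_sum)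
  also have "(\<Sum>x\<in>UNIV. 2 - 3 * (tr (h x))\<^sup>2) = 2 * m"
    by (simp add: sum_subtractf card_UNIV m_def G flip: sum_distrib_left)
  finally have "kloosterman z n a = of_int m"
    using of_nat_q3_bar_eq_0_iff[of 2] by simp
  moreover have "27 dvd 4 * m - (9 * corr 2 a - 3 * corr 1 a)"
  proof -
    define A where "A = (\<Sum>x\<in>UNIV. (tr (a * x))\<^sup>2)"
    have "(\<Sum>x\<in>UNIV. 2 * (tr (h x))\<^sup>2) = (\<Sum>x\<in>UNIV. 2 * (tr (inverse x))\<^sup>2 + 2 * (tr (a * x))\<^sup>2
        - 3 * (tr (inverse x) * tr (a * x))\<^sup>2 + (tr (inverse x) * tr (a * x)) ^ 1)"
      by (simp only: h_def tr_add_square power_one_right)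
    also have "\<dots> = 2 * (\<Sum>x\<in>UNIV. (tr x)\<^sup>2) + 2 * A - 3 * corr 2 a + corr 1 a"
      using sum_inverse[of "\<lambda>x. (tr x)\<^sup>2"]
      by (simp only: sum.distrib sum_subtractf A_def corr_def flip: sum_distrib_left)
    also have "(\<Sum>x\<in>UNIV. 2 * (tr (h x))\<^sup>2) = 4 * H"
      by (simp add: G flip: sum_distrib_left)
    finally have "4 * m - (9 * corr 2 a - 3 * corr 1 a) = - 6 * A"
      using sum_tr_square by (simp add: m_def)
    \<comment> \<open>For nonzero \<open>a\<close> rescaling turns \<open>A\<close> into the full
      square sum; for \<open>a = 0\<close> every term vanishes.\<close>
    moreover have "A = 0 \<or> 3 * A = 2 * 3 ^ n"
      using sum_mult_left[of a "\<lambda>x. (tr x)\<^sup>2"] sum_tr_square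
      by (cases "a = 0") (simp_all add: A_def tr_0)
    then have "27 dvd 6 * A"
    proof
      assume "3 * A = 2 * 3 ^ n"
      then have "6 * A = 4 * 3 ^ n" by simp
      also have "\<dots> = 27 * (4 * 3 ^ (n - 3))"
        using power_add[of "3 :: int" 3 "n - 3"] n by simp
      finally show ?thesis by simp
    qed simp
    ultimately show ?thesis by simp
  qed
  ultimately show thesis by (rule that)
qed

end

section \<open>Teichmueller characters\<close>

lemma sum_two_powers_3_bounds:
  assumes "i \<le> j"
  shows "(3::nat) ^ j < 3 ^ i + 3 ^ j" "(3::nat) ^ i + 3 ^ j < 3 ^ Suc j"
proof -
  have "(3::nat) ^ i \<le> 3 ^ j" "(0::nat) < 3 ^ i"
    using assms by (auto intro: power_increasing)
  then show "(3::nat) ^ j < 3 ^ i + 3 ^ j" "(3::nat) ^ i + 3 ^ j < 3 ^ Suc j"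
    unfolding power_Suc by linarith+
qed

text \<open>The sum lies strictly between \<open>3 ^ j\<close> and \<open>3 ^ Suc j\<close>, so its
  size determines the larger exponent; cancellation then gives the smaller one.\<close>

lemma sum_two_powers_3_eq_ordered:
  assumes "(3::nat) ^ i + 3 ^ j = 3 ^ k + 3 ^ l" "i \<le> j" "k \<le> l"
  shows "i = k \<and> j = l"
proof -
  have "(3::nat) ^ j < 3 ^ Suc l" "(3::nat) ^ l < 3 ^ Suc j"
    using sum_two_powers_3_bounds[OF assms(2)] sum_two_powers_3_bounds[OF assms(3)] assms(1)
    by linarith+
  then have "j < Suc l" "l < Suc j"
    by (simp_all only: power_strict_increasing_iff)
  then have "j = l" by simp
  with assms(1) have "(3::nat) ^ i = 3 ^ k" by simp
  with \<open>j = l\<close> show ?thesis by simp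
qed

lemma sum_two_powers_3_eq:
  assumes "(3::nat) ^ i + 3 ^ j = 3 ^ k + 3 ^ l"
  shows "i = k \<and> j = l \<or> i = l \<and> j = k"
  using sum_two_powers_3_eq_ordered[of i j k l] sum_two_powers_3_eq_ordered[of j i k l]
    sum_two_powers_3_eq_ordered[of i j l k] sum_two_powers_3_eq_ordered[of j i l k] assms
  by (metis add.commute nle_le)

lemma sum_two_powers_3_less:
  assumes "i < n" "j < n" "n \<ge> 2"
  shows "(3::nat) ^ i + 3 ^ j < 3 ^ n - 1"
proof -
  obtain k where k: "n = Suc (Suc k)"
    using assms(3) by (metis add_2_eq_Suc le_Suc_ex)
  have "(3::nat) ^ i \<le> 3 ^ Suc k" "(3::nat) ^ j \<le> 3 ^ Suc k" "(0::nat) < 3 ^ k"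
    using assms k by (auto intro: power_increasing simp del: power_Suc)
  then show ?thesis unfolding k power_Suc by linarith
qed

text \<open>The strict bound \<open>i < m\<close> excludes three equal summands, whose sum would be
  the next power of 3.\<close>

lemma sum_three_powers_3_bounds:
  assumes "i < m" "j \<le> m"
  shows "(3::nat) ^ m < 3 ^ i + 3 ^ j + 3 ^ m" "(3::nat) ^ i + 3 ^ j + 3 ^ m < 3 ^ Suc m - 1"
proof -
  obtain k where k: "m = Suc k"
    using assms(1) by (metis Nat.lessE)
  have "(3::nat) ^ i \<le> 3 ^ k" "(3::nat) ^ j \<le> 3 ^ Suc k" "(0::nat) < 3 ^ k" "(0::nat) < 3 ^ i"
    using assms k by (auto intro: power_increasing simp del: power_Suc)
  then show "(3::nat) ^ m < 3 ^ i + 3 ^ j + 3 ^ m" "(3::nat) ^ i + 3 ^ j + 3 ^ m < 3 ^ Suc m - 1"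
    unfolding k power_Suc by linarith+
qed

lemma sum_three_powers_3_neq_power:
  assumes "i < m" "j \<le> m"
  shows "(3::nat) ^ k \<noteq> 3 ^ i + 3 ^ j + 3 ^ m"
proof
  assume "(3::nat) ^ k = 3 ^ i + 3 ^ j + 3 ^ m"
  then have "(3::nat) ^ m < 3 ^ k" "(3::nat) ^ k < 3 ^ Suc m"
    using sum_three_powers_3_bounds[OF assms] by linarith+
  then have "m < k" "k < Suc m"
    by (simp_all only: power_strict_increasing_iff)
  then show False by simp
qed

lemma sum_three_powers_3_less:
  assumes "i < m" "j \<le> m" "m < n"
  shows "(3::nat) ^ i + 3 ^ j + 3 ^ m < 3 ^ n - 1"
proof -
  have "(3::nat) ^ Suc m \<le> 3 ^ n"
    using assms(3) by (intro power_increasing) auto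
  then show ?thesis using sum_three_powers_3_bounds(2)[OF assms(1,2)] by linarith
qed

lemma X_set_eq:
  assumes "n \<ge> 2"
  shows "X_set n = (\<lambda>(i, j). 3 ^ i + 3 ^ j) ` ({..<n} \<times> {..<n})"
  using sum_two_powers_3_less[OF _ _ assms] by (fastforce simp: X_set_def image_iff)

text \<open>The fiber consists of \<open>(i, j)\<close> and \<open>(j, i)\<close>, which coincide
  when \<open>i = j\<close>. What matters later is that both sizes square to 1 modulo 3.\<close>

lemma card_sum_two_powers_3_fiber:
  assumes "s \<in> (\<lambda>(i, j). 3 ^ i + 3 ^ j) ` ({..<n} \<times> {..<n})"
  shows "card {p \<in> {..<n} \<times> {..<n}. (\<lambda>(i, j). 3 ^ i + 3 ^ j) p = (s :: nat)} \<in> {1, 2}"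
proof -
  obtain i j where ij: "s = 3 ^ i + 3 ^ j" "i < n" "j < n"
    using assms by auto
  have "{p \<in> {..<n} \<times> {..<n}. (\<lambda>(i, j). 3 ^ i + 3 ^ j) p = s} = {(i, j), (j, i)}"
    using ij by (auto dest: sum_two_powers_3_eq)
  then show ?thesis by (cases "i = j") auto
qed

text \<open>Mixed terms are sorted by their largest index \<open>m\<close>. Adding a top term
  \<open>y\<close> to \<open>p\<close> contributes \<open>3 * (p * (p + y) * y)\<close>, whose
  factors \<open>p\<close> and \<open>p + y\<close> account for the ranges \<open>i < m\<close> and
  \<open>j \<le> m\<close>.\<close>

lemma sum_powers_3_cube:
  fixes z :: "'a::comm_ring_1"
  shows "(\<Sum>i<n. z ^ 3 ^ i) ^ 3 = (\<Sum>i<n. z ^ 3 ^ Suc i)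
    + 3 * (\<Sum>(m, i, j)\<in>(SIGMA m:{..<n}. {..<m} \<times> {..m}). z ^ (3 ^ i + 3 ^ j + 3 ^ m))"
proof -
  have "(\<Sum>i<n. z ^ 3 ^ i) ^ 3 = (\<Sum>i<n. z ^ 3 ^ Suc i)
    + 3 * (\<Sum>m<n. (\<Sum>i<m. z ^ 3 ^ i) * (\<Sum>j\<le>m. z ^ 3 ^ j) * z ^ 3 ^ m)"
  proof (induction n)
    case (Suc n)
    define p y where "p = (\<Sum>i<n. z ^ 3 ^ i)" and "y = z ^ 3 ^ n"
    have "(p + y) ^ 3 = p ^ 3 + y ^ 3 + 3 * (p * (p + y) * y)"
      by (simp add: power3_eq_cube algebra_simps)
    moreover have "z ^ 3 ^ Suc n = y ^ 3"
      by (simp add: y_def mult.commute[of 3] flip: power_mult)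
    ultimately show ?case
      using Suc by (simp add: algebra_simps flip: lessThan_Suc_atMost p_def y_def)
  qed simp
  also have "(\<Sum>m<n. (\<Sum>i<m. z ^ 3 ^ i) * (\<Sum>j\<le>m. z ^ 3 ^ j) * z ^ 3 ^ m)
    = (\<Sum>m<n. \<Sum>(i, j)\<in>{..<m} \<times> {..m}. z ^ (3 ^ i + 3 ^ j + 3 ^ m))"
  proof (intro sum.cong refl)
    fix m
    have "(\<Sum>i<m. z ^ 3 ^ i) * (\<Sum>j\<le>m. z ^ 3 ^ j) * z ^ 3 ^ m
      = (\<Sum>(i, j)\<in>{..<m} \<times> {..m}. z ^ 3 ^ i * z ^ 3 ^ j) * z ^ 3 ^ m"
      by (simp only: sum_product sum.cartesian_product)
    also have "\<dots> = (\<Sum>(i, j)\<in>{..<m} \<times> {..m}. z ^ (3 ^ i + 3 ^ j + 3 ^ m))"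
      by (simp add: sum_distrib_right power_add case_prod_unfold)
    finally show "(\<Sum>i<m. z ^ 3 ^ i) * (\<Sum>j\<le>m. z ^ 3 ^ j) * z ^ 3 ^ m
      = (\<Sum>(i, j)\<in>{..<m} \<times> {..m}. z ^ (3 ^ i + 3 ^ j + 3 ^ m))" .
  qed
  also have "\<dots> = (\<Sum>(m, i, j)\<in>(SIGMA m:{..<n}. {..<m} \<times> {..m}). z ^ (3 ^ i + 3 ^ j + 3 ^ m))"
    by (subst sum.Sigma) auto
  finally show ?thesis .
qed

section \<open>The Teichmueller character and its orthogonality relations\<close>

locale teichmueller_character = ternary_field n t + z3_reduction N \<xi> red
  for n N and t :: "'f::{field,finite}" and \<xi> and red :: "q3_bar \<Rightarrow> 'f" +
  assumes n_ge_3: "n \<ge> 3"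
    and N_eq: "N = 3 ^ n - 1"
    and primitive: "primitive_root_of_unity N \<xi>"
    and red_xi: "red \<xi> = t"
begin

definition \<omega> :: "'f \<Rightarrow> q3_bar" where
  "\<omega> = teichmueller t \<xi>"

lemma t_power_N: "t ^ N = 1"
  and t_powers: "bij_betw (\<lambda>k. t ^ k) {..<N} (UNIV - {0})"
  using generates_units_bij_betw[OF generates] by (simp_all only: card_UNIV N_eq)

lemma xi_power_mod: "\<xi> ^ k = \<xi> ^ (k mod N)"
  by (metis mod_mult_div_eq mult_1_right power_add power_mult power_one xi_power)

lemma t_power_mod: "t ^ k = t ^ (k mod N)"
  using t_power_N
  by (metis mod_mult_div_eq mult_1_right power_add power_mult power_one)

lemma xi_power_inj:
  assumes "\<xi> ^ e = \<xi> ^ f" "e < N" "f < N"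
  shows "e = f"
proof -
  have "False" if eq: "\<xi> ^ e = \<xi> ^ f" and less: "e < f" "f < N" for e f
  proof -
    have "\<xi> \<noteq> 0"
      using xi_power m_pos by (metis power_0_left less_not_refl zero_neq_one)
    moreover have "\<xi> ^ e * \<xi> ^ (f - e) = \<xi> ^ f"
      using less by (simp flip: power_add)
    ultimately have "\<xi> ^ (f - e) = 1" using eq by auto
    then show False
      using primitive less by (auto simp: primitive_root_of_unity_def)
  qed
  from this[of e f] this[of f e] assms show ?thesis by (metis linorder_neqE_nat)
qed

lemma t_nonzero: "t \<noteq> 0"
  using generates by (simp add: generates_units_def)

lemma \<omega>_0: "\<omega> 0 = 0"
  by (simp add: \<omega>_def teichmueller_def)

text \<open>The least exponent chosen by \<open>teichmueller\<close> may differ from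
  \<open>k\<close>, but only by a multiple of \<open>N\<close>, which leaves the power of
  \<open>\<xi>\<close> unchanged.\<close>

lemma \<omega>_power: "\<omega> (t ^ k) = \<xi> ^ k"
proof -
  define l where "l = (LEAST l. t ^ k = t ^ l)"
  have "t ^ k = t ^ l"
    unfolding l_def by (rule LeastI[of _ k]) simp
  then have "t ^ (k mod N) = t ^ (l mod N)"
    by (simp flip: t_power_mod)
  then have "k mod N = l mod N"
    using t_powers m_pos
    by (auto simp: bij_betw_def dest: inj_onD)
  then have "\<xi> ^ k = \<xi> ^ l"
    using xi_power_mod by metis
  then show ?thesis
    by (simp add: \<omega>_def teichmueller_def l_def t_nonzero)
qed

lemma nonzero_cases:
  assumes "(x :: 'f) \<noteq> 0"
  obtains k where "x = t ^ k"
  using assms generates by (auto simp: generates_units_def)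

lemma \<omega>_mult: "\<omega> (x * y) = \<omega> x * \<omega> y"
proof (cases "x = 0 \<or> y = 0")
  case False
  then obtain k l where "x = t ^ k" "y = t ^ l" by (auto elim!: nonzero_cases)
  then show ?thesis by (simp add: \<omega>_power flip: power_add)
qed (auto simp: \<omega>_0)

lemma \<omega>_1: "\<omega> 1 = 1"
  using \<omega>_power[of 0] by simp

lemma \<omega>_R: "\<omega> x \<in> R"
  by (cases "x = 0") (auto simp: \<omega>_0 \<omega>_power elim!: nonzero_cases intro: R_intros)

lemma red_\<omega>: "red (\<omega> x) = x"
proof (cases "x = 0")
  case False
  then obtain k where "x = t ^ k" by (rule nonzero_cases)
  then show ?thesis
    using red_power[OF R_power[of 1], of k] by (simp add: \<omega>_power red_xi)
qed (simp add: \<omega>_0 red_0)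

lemma \<omega>_power_card: "\<omega> x ^ 3 ^ n = \<omega> x"
proof -
  have "x ^ 3 ^ n = x" by (rule power_card)
  moreover have "\<omega> (x ^ k) = \<omega> x ^ k" for k
    by (induction k) (simp_all add: \<omega>_1 \<omega>_mult)
  ultimately show ?thesis by metis
qed

text \<open>Positive exponents make the term at 0 vanish, leaving \<open>N\<close> equal terms if
  \<open>e = f\<close>. Otherwise replacing \<open>x\<close> by \<open>t * x\<close> multiplies the
  sum by \<open>w\<close>, which is \<open>\<xi>\<close> to the power \<open>f - e\<close> and
  differs from 1.\<close>

lemma character_orthogonality:
  assumes "0 < e" "e < N" "0 < f" "f < N"
  shows "(\<Sum>x\<in>UNIV. \<omega> (inverse x) ^ e * \<omega> (a * x) ^ f) =
    (if e = f then of_nat N * \<omega> a ^ f else 0)"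
proof (cases "e = f")
  case True
  have "\<omega> (inverse x) ^ e * \<omega> (a * x) ^ e = (if x \<in> - {0} then \<omega> a ^ e else 0)" for x
    using assms(1) by (auto simp: \<omega>_0 field_simps simp flip: power_mult_distrib \<omega>_mult)
  then have "(\<Sum>x\<in>UNIV. \<omega> (inverse x) ^ e * \<omega> (a * x) ^ e) = (\<Sum>x\<in>- {0::'f}. \<omega> a ^ e)"
    using sum.inter_restrict[of UNIV "\<lambda>_. \<omega> a ^ e" "- {0::'f}"] by simp
  also have "\<dots> = of_nat N * \<omega> a ^ e"
    by (simp add: Compl_eq_Diff_UNIV card_Diff_singleton card_UNIV N_eq)
  finally show ?thesis using True by simp
next
  case False
  let ?h = "\<lambda>x. \<omega> (inverse x) ^ e * \<omega> (a * x) ^ f"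
  define w where "w = \<omega> (inverse t) ^ e * \<xi> ^ f"
  have "?h (t * x) = w * ?h x" for x
    using \<omega>_power[of 1]
    by (simp add: w_def \<omega>_mult inverse_mult_distrib power_mult_distrib mult.left_commute)
  then have "(\<Sum>x\<in>UNIV. ?h x) = w * (\<Sum>x\<in>UNIV. ?h x)"
    using sum_mult_left[OF t_nonzero, of ?h] by (simp flip: sum_distrib_left)
  moreover have "w \<noteq> 1"
  proof
    assume "w = 1"
    have "\<xi> * \<omega> (inverse t) = 1"
      using \<omega>_mult[of t "inverse t"] \<omega>_power[of 1] t_nonzero by (simp add: \<omega>_1)
    then have "\<xi> ^ e * \<omega> (inverse t) ^ e = 1"
      by (simp flip: power_mult_distrib)
    then have "\<xi> ^ e * w = \<xi> ^ f"
      by (simp add: w_def flip: mult.assoc)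
    with \<open>w = 1\<close> have "\<xi> ^ e = \<xi> ^ f" by simp
    then show False using xi_power_inj assms False by blast
  qed
  ultimately show ?thesis using False by simp
qed

lemma character_sum_orthogonality:
  assumes "\<And>i. i \<in> A \<Longrightarrow> 0 < e i \<and> e i < N" "\<And>j. j \<in> B \<Longrightarrow> 0 < f j \<and> f j < N"
  shows "(\<Sum>x\<in>UNIV. (\<Sum>i\<in>A. \<omega> (inverse x) ^ e i) * (\<Sum>j\<in>B. \<omega> (a * x) ^ f j)) =
    of_nat N * (\<Sum>j\<in>B. \<Sum>i\<in>A. if e i = f j then \<omega> a ^ f j else 0)"
proof -
  have "(\<Sum>x\<in>UNIV. (\<Sum>i\<in>A. \<omega> (inverse x) ^ e i) * (\<Sum>j\<in>B. \<omega> (a * x) ^ f j)) =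
    (\<Sum>j\<in>B. \<Sum>i\<in>A. \<Sum>x\<in>UNIV. \<omega> (inverse x) ^ e i * \<omega> (a * x) ^ f j)"
    unfolding sum_product
    by (subst sum.swap, subst (2) sum.swap, subst sum.swap) (rule refl)
  also have "\<dots> = (\<Sum>j\<in>B. \<Sum>i\<in>A. if e i = f j then of_nat N * \<omega> a ^ f j else 0)"
    using assms by (intro sum.cong character_orthogonality refl) auto
  also have "\<dots> = of_nat N * (\<Sum>j\<in>B. \<Sum>i\<in>A. if e i = f j then \<omega> a ^ f j else 0)"
    by (auto simp: sum_distrib_left intro!: sum.cong)
  finally show ?thesis .
qed

section \<open>The lifted trace and the two correlation sums\<close>

definition S :: "'f \<Rightarrow> q3_bar" where
  "S c = (\<Sum>i<n. \<omega> c ^ 3 ^ i)"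

text \<open>These triples index the mixed terms of the cube of \<open>S\<close>, with
  \<open>m\<close> the largest index; the resulting exponents are never powers of 3.\<close>

definition T :: "(nat \<times> nat \<times> nat) set" where
  "T = (SIGMA m:{..<n}. {..<m} \<times> {..m})"

definition M :: "'f \<Rightarrow> q3_bar" where
  "M c = (\<Sum>p\<in>T. \<omega> c ^ (case p of (m, i, j) \<Rightarrow> 3 ^ i + 3 ^ j + 3 ^ m))"

lemma S_R: "S c \<in> R" and M_R: "M c \<in> R"
  by (auto simp: S_def M_def intro!: R_sum R_pow \<omega>_R)

lemma S_cube: "S c ^ 3 = S c + 3 * M c"
proof -
  have "S c ^ 3 = (\<Sum>i<n. \<omega> c ^ 3 ^ Suc i) + 3 * M c"
    unfolding S_def sum_powers_3_cube M_def T_def by (simp add: case_prod_unfold)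
  also have "(\<Sum>i<n. \<omega> c ^ 3 ^ Suc i) = (\<Sum>i<Suc n. \<omega> c ^ 3 ^ i) - \<omega> c"
    by (subst sum.lessThan_Suc_shift) simp
  also have "\<dots> = S c"
    by (simp add: S_def \<omega>_power_card)
  finally show ?thesis .
qed

text \<open>The difference reduces to 0 and is fixed by cubing modulo 3, because \<open>tr\<close>
  is fixed by cubing and \<open>S_cube\<close> holds; so \<open>red_eq_0_imp_dvd\<close>
  applies.\<close>

lemma S_cong_tr: "S c - of_int (tr c) \<in> I (Suc 0)"
proof (rule red_eq_0_imp_dvd)
  let ?e = "of_int (tr c) :: q3_bar"
  show R: "S c - ?e \<in> R"
    by (intro R_intros S_R)
  have "red (S c) = abs_trace n c"
    by (simp add: S_def abs_trace_def red_sum red_power red_\<omega> \<omega>_R R_pow)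
  then show "red (S c - ?e) = 0"
    by (simp add: red_diff S_R R_of_int red_of_int of_int_tr)
  have e: "?e * (?e * ?e) = ?e"
    using arg_cong[OF tr_cube[of c], of "of_int :: int \<Rightarrow> q3_bar"] by (simp add: power3_eq_cube mult.assoc)
  have "(S c - ?e) ^ 3 - (S c - ?e)
    = (S c ^ 3 - S c) + 3 * (S c * ?e * ?e - S c * S c * ?e) + (?e - ?e * (?e * ?e))"
    by (simp add: power3_eq_cube algebra_simps)
  also have "\<dots> = 3 ^ Suc 0 * (M c + S c * ?e * ?e - S c * S c * ?e)"
    unfolding e S_cube by (simp add: algebra_simps)
  also have "\<dots> \<in> I (Suc 0)"
    by (intro I_power3 R_intros S_R M_R)
  finally show "(S c - ?e) ^ 3 - (S c - ?e) \<in> I (Suc 0)" .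
qed

text \<open>Cubing lifts the congruence from modulus 3 to modulus 9 and leaves the integer
  \<open>tr c\<close> unchanged.\<close>

lemma tr_cong: "of_int (tr c) - (S c + 3 * M c) \<in> I 2"
proof -
  have "of_int (tr c) - S c \<in> I (Suc 0)"
    using I_uminus[OF S_cong_tr[of c]] by simp
  then have "of_int (tr c) ^ 3 - S c ^ 3 \<in> I (Suc (Suc 0))"
    by (intro cube_cong R_of_int S_R)
  then show ?thesis
    using tr_cube[of c] by (simp add: S_cube numeral_2_eq_2 flip: of_int_power)
qed

lemma power_3_bounds: "i < n \<Longrightarrow> 0 < (3::nat) ^ i \<and> (3::nat) ^ i < N"
  using sum_two_powers_3_less[of i n i] n_ge_3 unfolding N_eq by simp

lemma T_bounds: "p \<in> T \<Longrightarrow> 0 < (case p of (m, i, j) \<Rightarrow> (3::nat) ^ i + 3 ^ j + 3 ^ m) \<and>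
    (case p of (m, i, j) \<Rightarrow> (3::nat) ^ i + 3 ^ j + 3 ^ m) < N"
  using sum_three_powers_3_less unfolding N_eq by (auto simp: T_def)

text \<open>Since \<open>N = 3 ^ n - 1\<close>, the factor \<open>N\<close> produced by
  orthogonality acts as -1; this is the source of the signs in both correlation congruences.\<close>

lemma N_cong: "of_nat N * y + y \<in> I n" if "y \<in> R"
  using I_power3[OF that, of n] by (simp add: N_eq algebra_simps of_nat_diff)

lemma sum_S_S: "(\<Sum>x\<in>UNIV. S (inverse x) * S (a * x)) = of_nat N * S a"
  unfolding S_def using power_3_bounds
  by (subst character_sum_orthogonality) (auto simp: sum.delta)

text \<open>No exponent occurring in \<open>M\<close> is a power of 3, so orthogonality meets no
  matching pair.\<close>

lemma sum_S_M: "(\<Sum>x\<in>UNIV. S (inverse x) * M (a * x)) = 0"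
proof -
  have "(3::nat) ^ k \<noteq> (case p of (m, i, j) \<Rightarrow> 3 ^ i + 3 ^ j + 3 ^ m)" if "p \<in> T" for k p
    using that sum_three_powers_3_neq_power by (auto simp: T_def)
  then show ?thesis
    unfolding S_def M_def using power_3_bounds T_bounds
    by (subst character_sum_orthogonality) (auto)
qed

lemma sum_M_S: "(\<Sum>x\<in>UNIV. M (inverse x) * S (a * x)) = 0"
proof -
  have "(case p of (m, i, j) \<Rightarrow> 3 ^ i + 3 ^ j + 3 ^ m) \<noteq> (3::nat) ^ k" if "p \<in> T" for k p
    using that sum_three_powers_3_neq_power by (fastforce simp: T_def)
  then show ?thesis
    unfolding S_def M_def using power_3_bounds T_bounds
    by (subst character_sum_orthogonality) (auto)
qed

lemma corr_1_cong: "of_int (corr 1 a) + S a \<in> I 2"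
proof -
  let ?e = "\<lambda>c. of_int (tr c) :: q3_bar"
  have "?e u * ?e v - (S u * S v + 3 * (S u * M v) + 3 * (M u * S v)) \<in> I 2" for u v
  proof -
    \<comment> \<open>The product of the two \<open>M\<close> terms carries a factor 9 and is
      absorbed; only products involving \<open>S\<close> remain for orthogonality.\<close>
    have "?e u * ?e v - (S u * S v + 3 * (S u * M v) + 3 * (M u * S v)) =
      (?e u - (S u + 3 * M u)) * ?e v + (S u + 3 * M u) * (?e v - (S v + 3 * M v))
      + 3 ^ 2 * (M u * M v)"
      by (simp add: algebra_simps)
    also have "\<dots> \<in> I 2"
      by (intro I_add I_mult[OF tr_cong] I_mult'[OF tr_cong] I_power3 R_intros S_R M_R)
    finally show ?thesis .
  qed
  then have "(\<Sum>x\<in>UNIV. ?e (inverse x) * ?e (a * x) - (S (inverse x) * S (a * x)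
      + 3 * (S (inverse x) * M (a * x)) + 3 * (M (inverse x) * S (a * x)))) \<in> I 2"
    by (intro I_sum)
  then have "of_int (corr 1 a) - of_nat N * S a \<in> I 2"
    by (simp add: sum_subtractf sum.distrib sum_S_S sum_S_M sum_M_S corr_def
      flip: sum_distrib_left)
  moreover have "of_nat N * S a + S a \<in> I 2"
    by (rule I_mono[OF N_cong[OF S_R]]) (use n_ge_3 in simp)
  ultimately show ?thesis
    using I_add by fastforce
qed

text \<open>Modulo 3 the lift \<open>S\<close> alone replaces \<open>tr\<close>. Its square is a
  character sum over ordered pairs, so orthogonality weights each element of \<open>X_set n\<close>
  by the square of its number of representations, which is 1 modulo 3.\<close>

lemma corr_2_cong: "of_int (corr 2 a) + tau_hat (X_set n) \<omega> a \<in> I (Suc 0)"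
proof -
  let ?e = "\<lambda>c. of_int (tr c) :: q3_bar"
  define g :: "nat \<times> nat \<Rightarrow> nat" where "g = (\<lambda>(i, j). 3 ^ i + 3 ^ j)"
  define D where "D = {..<n} \<times> {..<n}"
  define C where "C s = card {p \<in> D. g p = s}" for s
  have X: "X_set n = g ` D"
    using X_set_eq n_ge_3 by (simp add: g_def D_def)
  have g_bounds: "0 < g p \<and> g p < N" if "p \<in> D" for p
    using that sum_two_powers_3_less n_ge_3 unfolding N_eq by (auto simp: D_def g_def)
  have S_square: "S c ^ 2 = (\<Sum>p\<in>D. \<omega> c ^ g p)" for c
    by (simp add: S_def power2_eq_square sum_product sum.cartesian_product D_def g_def
      case_prod_unfold power_add)
  have "(\<Sum>x\<in>UNIV. S (inverse x) ^ 2 * S (a * x) ^ 2)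
    = of_nat N * (\<Sum>q\<in>D. \<Sum>p\<in>D. if g p = g q then \<omega> a ^ g q else 0)"
    unfolding S_square using g_bounds by (intro character_sum_orthogonality)
  also have "(\<Sum>q\<in>D. \<Sum>p\<in>D. if g p = g q then \<omega> a ^ g q else 0) = (\<Sum>q\<in>D. of_nat (C (g q)) * \<omega> a ^ g q)"
    by (simp add: C_def D_def flip: sum.inter_filter)
  \<comment> \<open>The matching pairs \<open>p\<close> already gave one factor \<open>C s\<close>;
    collecting the \<open>q\<close> with the same exponent gives the second.\<close>
  also have "\<dots> = (\<Sum>s\<in>g ` D. of_nat (C s) ^ 2 * \<omega> a ^ s)"
    by (subst sum.image_gen[of _ _ g])
      (simp_all add: C_def D_def power2_eq_square mult.assoc)
  finally have sum: "(\<Sum>x\<in>UNIV. S (inverse x) ^ 2 * S (a * x) ^ 2)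
    = of_nat N * (\<Sum>s\<in>g ` D. of_nat (C s) ^ 2 * \<omega> a ^ s)" .
  have "?e u ^ 2 * ?e v ^ 2 - S u ^ 2 * S v ^ 2 \<in> I (Suc 0)" for u v
  proof -
    have "?e u ^ 2 * ?e v ^ 2 - S u ^ 2 * S v ^ 2
      = - ((S u - ?e u) * ((S u + ?e u) * ?e v ^ 2) + (S v - ?e v) * ((S v + ?e v) * S u ^ 2))"
      by (simp add: power2_eq_square algebra_simps)
    also have "\<dots> \<in> I (Suc 0)"
      by (intro I_uminus I_add I_mult[OF S_cong_tr] R_intros S_R)
    finally show ?thesis .
  qed
  then have "(\<Sum>x\<in>UNIV. ?e (inverse x) ^ 2 * ?e (a * x) ^ 2 - S (inverse x) ^ 2 * S (a * x) ^ 2) \<in> I (Suc 0)"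
    by (intro I_sum)
  then have 1: "of_int (corr 2 a) - of_nat N * (\<Sum>s\<in>g ` D. of_nat (C s) ^ 2 * \<omega> a ^ s) \<in> I (Suc 0)"
    unfolding sum_subtractf sum by (simp add: corr_def power_mult_distrib)
  have 2: "of_nat N * (\<Sum>s\<in>g ` D. of_nat (C s) ^ 2 * \<omega> a ^ s)
    + (\<Sum>s\<in>g ` D. of_nat (C s) ^ 2 * \<omega> a ^ s) \<in> I (Suc 0)"
    by (rule I_mono[OF N_cong]) (use n_pos in \<open>auto intro!: R_intros \<omega>_R\<close>)
  have "(of_nat (C s) ^ 2 - 1) * \<omega> a ^ s \<in> I (Suc 0)" if "s \<in> g ` D" for s
  proof -
    have "C s = 1 \<or> C s = 2"
      using card_sum_two_powers_3_fiber[of s n] that by (auto simp: C_def g_def D_def)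
    then have "of_nat (C s) ^ 2 - 1 = (3 ^ Suc 0 * 0 :: q3_bar) \<or> of_nat (C s) ^ 2 - 1 = (3 ^ Suc 0 * 1 :: q3_bar)"
      by (auto simp: power2_eq_square)
    then have "(of_nat (C s) ^ 2 - 1 :: q3_bar) \<in> I (Suc 0)"
      using I_power3[OF R_0] I_power3[OF R_1] by metis
    then show ?thesis by (intro I_mult R_pow \<omega>_R)
  qed
  then have "(\<Sum>s\<in>g ` D. (of_nat (C s) ^ 2 - 1) * \<omega> a ^ s) \<in> I (Suc 0)"
    by (rule I_sum)
  then have 3: "(\<Sum>s\<in>g ` D. of_nat (C s) ^ 2 * \<omega> a ^ s) - tau_hat (X_set n) \<omega> a \<in> I (Suc 0)"
    by (simp add: tau_hat_def X left_diff_distrib sum_subtractf)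
  from I_diff[OF I_add[OF 1 2] 3] show ?thesis by simp
qed

lemma kloosterman_cong:
  assumes "primitive_root_of_unity 3 \<zeta>"
  shows "kloosterman \<zeta> n a \<in> R"
    and "21 * trace_hat n \<omega> a + 18 * tau_hat (X_set n) \<omega> a \<in> R"
    and "kloosterman \<zeta> n a - (21 * trace_hat n \<omega> a + 18 * tau_hat (X_set n) \<omega> a) \<in> I 3"
proof -
  let ?\<tau> = "tau_hat (X_set n) \<omega> a"
  have S: "trace_hat n \<omega> a = S a"
    by (simp add: trace_hat_def S_def)
  have \<tau>: "?\<tau> \<in> R"
    by (auto simp: tau_hat_def intro!: R_sum R_pow \<omega>_R)
  obtain k where k: "kloosterman \<zeta> n a = of_int k" "27 dvd 4 * k - (9 * corr 2 a - 3 * corr 1 a)"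
    by (rule kloosterman_integer[OF assms n_ge_3])
  then obtain d where d: "4 * k = 9 * corr 2 a - 3 * corr 1 a + 27 * d"
    by (auto elim!: dvdE simp: algebra_simps)
  have "4 * of_int k = 9 * of_int (corr 2 a) - 3 * of_int (corr 1 a) + 27 * (of_int d :: q3_bar)"
    using arg_cong[OF d, of "of_int :: int \<Rightarrow> q3_bar"] by simp
  \<comment> \<open>Here 7 is the inverse of 4 modulo 27. The signs in the two correlation
    congruences then give the coefficients \<open>21 = 7 * 3\<close> and
    \<open>18 = 81 - 63\<close>.\<close>
  then have "7 * (4 * of_int k)
      = 7 * (9 * of_int (corr 2 a) - 3 * of_int (corr 1 a) + 27 * (of_int d :: q3_bar))"
    by (rule arg_cong)
  then have eq: "of_int k - (21 * S a + 18 * ?\<tau>) = 7 * (3 ^ 2 * 1 * (of_int (corr 2 a) + ?\<tau>))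
    - 7 * (3 ^ Suc 0 * 1 * (of_int (corr 1 a) + S a)) + 3 ^ 3 * (7 * of_int d - of_int k - 3 * ?\<tau>)"
    by (simp add: algebra_simps)
  show "kloosterman \<zeta> n a \<in> R"
    by (simp add: k R_of_int)
  show "21 * trace_hat n \<omega> a + 18 * ?\<tau> \<in> R"
    unfolding S by (intro R_intros S_R \<tau>)
  have "3 ^ 2 * 1 * (of_int (corr 2 a) + ?\<tau>) \<in> I 3" "3 ^ Suc 0 * 1 * (of_int (corr 1 a) + S a) \<in> I 3"
    using I_mult_I[OF I_power3[OF R_1, of 2] corr_2_cong[of a]]
      I_mult_I[OF I_power3[OF R_1, of "Suc 0"] corr_1_cong[of a]]
    by (simp_all add: numeral_3_eq_3)
  note multiples = this[THEN I_mult'[OF _ R_numeral]]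
  have rest: "3 ^ 3 * (7 * of_int d - of_int k - 3 * ?\<tau>) \<in> I 3"
    by (intro I_power3 R_intros \<tau>)
  show "kloosterman \<zeta> n a - (21 * trace_hat n \<omega> a + 18 * ?\<tau>) \<in> I 3"
    unfolding k S eq by (rule I_add[OF I_diff[OF multiples] rest])
qed

end

theorem theorem4p3:
  fixes n q :: nat
    and a t :: "'f::{field,finite}"
    and \<zeta> \<xi> :: q3_bar
    and red :: "q3_bar \<Rightarrow> 'f"
    and \<omega> :: "'f \<Rightarrow> q3_bar"
  assumes "n \<ge> 3"
    and "q = 3 ^ n"
    and "card (UNIV :: 'f set) = q"
    and "primitive_root_of_unity (q - 1) \<xi>"
    and "primitive_root_of_unity 3 \<zeta>"
    and "reduction_map (q3_adjoin {\<xi>}) red"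
    and "generates_units t"
    and "red \<xi> = t"
    and "\<omega> = teichmueller t \<xi>"
  shows "cong_in (ring_of_integers (q3_adjoin {\<zeta>, \<xi>}))
           (kloosterman \<zeta> n a)
           (21 * trace_hat n \<omega> a + 18 * tau_hat (X_set n) \<omega> a)
           27"
proof -
  interpret ternary_field n t
    using assms by unfold_locales simp_all
  have "(3::nat) ^ n > 1"
    using power_strict_increasing[of 0 n "3::nat"] n_pos by simp
  then interpret z3_root_of_unity "q - 1" \<xi>
    using assms by unfold_locales (simp_all add: primitive_root_of_unity_def)
  \<comment> \<open>The given reduction is a homomorphism on the integers of
    \<open>Q_3(\<xi>)\<close>; this inclusion restricts it to \<open>Z_3[\<xi>]\<close>.\<close>
  have R: "x \<in> ring_of_integers (q3_adjoin {\<xi>})" if "x \<in> R" for x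
    using R_subset_ring_of_integers[of "{\<xi>}"] that by auto
  note hom = assms(6)[unfolded reduction_map_def]
  interpret teichmueller_character n "q - 1" t \<xi> red
  proof unfold_locales
    show "red (x + y) = red x + red y" if "x \<in> R" "y \<in> R" for x y
      using ring_hom_add[OF hom, of x y] that R by (simp add: ring_of_type_algebra_def)
    show "red (x * y) = red x * red y" if "x \<in> R" "y \<in> R" for x y
      using ring_hom_mult[OF hom, of x y] that R by (simp add: ring_of_type_algebra_def)
    show "red 1 = 1"
      using ring_hom_one[OF hom] by (simp add: ring_of_type_algebra_def)
  qed (use assms three_eq_0 in simp_all)
  have "\<omega> = teichmueller_character.\<omega> t \<xi>"
    using assms \<omega>_def by simp
  note cong = kloosterman_cong[OF assms(5), of a, folded this]
  \<comment> \<open>Both sides and the quotient by 27 already lie in \<open>Z_3[\<xi>]\<close>, so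
    this inclusion transfers the congruence to the larger ring.\<close>
  have subset: "R \<subseteq> ring_of_integers (q3_adjoin {\<zeta>, \<xi>})"
    by (rule R_subset_ring_of_integers) simp
  obtain r where r: "r \<in> R"
    "kloosterman \<zeta> n a - (21 * trace_hat n \<omega> a + 18 * tau_hat (X_set n) \<omega> a) = 3 ^ 3 * r"
    using cong(3) unfolding I_def by blast
  show ?thesis
    unfolding cong_in_def
  proof (intro conjI bexI)
    show "kloosterman \<zeta> n a - (21 * trace_hat n \<omega> a + 18 * tau_hat (X_set n) \<omega> a) = 27 * r"
      using r(2) by simp
  qed (use subset cong(1,2) r(1) in blast)+
qed

end
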